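(* Let $G$ be a finitely generated group that is hyperbolic relative to a finite family of finitely generated subgroups $(H_i)_i$. For each $i$, let $S_i$ be a finite generating set for $H_i$. Then there is a connected graph $\Gamma$ with a free cocompact action of $G$ by graph automorphisms, together with subgraphs $(\Gamma_i)_i$ of $\Gamma$, such that, for each $i$, 1. $\Gamma_i$ is (isomorphic to) a Rips graph of $\mathrm{Cay}(H_i,S_i)$, 2. $H_i$ stabilizes $\Gamma_i$, 3. the $H_i$-action on $\Gamma_i$ is free and cocompact, and 4. $\Gamma_i$ is convex in $\Gamma$.
   Context: **Graphs.** Connected graphs are regarded as geodesic metric spaces with edges of length $1$; $d_\Lambda$ is the path metric of a graph $\Lambda$ and $\Lambda^{(0)}$ its vertex set. A subgraph is convex if every geodesic of the ambient graph with endpoints in the subgraph is contained in the subgraph. An action on a graph is free if it is free on the vertex set (edge inversions are allowed, as for Cayley graphs), and cocompact if there are finitely many orbits of vertices and edges. **Rips graph.** For $k\in\mathbb N$, the Rips graph $\mathrm{Rips}_k(\Lambda)$ of a graph $\Lambda$ is the graph with vertex set $\Lambda^{(0)}$ in which two distinct vertices are joined by an edge iff they are at distance at most $k$ in $\Lambda$. "A Rips graph of $\Lambda$" means $\mathrm{Rips}_k(\Lambda)$ for some $k$. **Combinatorial horoball.** For a connected graph $\Lambda$, the combinatorial horoball $\mathcal H(\Lambda)$ is the graph with vertex set $\Lambda^{(0)}\times\mathbb N_0$ and with edges: (vertical) between $(v,n)$ and $(v,n+1)$ for all $v\in\Lambda^{(0)}$, $n\in\mathbb N_0$; (horizontal)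 between $(v,n)$ and $(w,n)$ whenever $0<d_\Lambda(v,w)\le 2^n$. The subgraph spanned by $\Lambda^{(0)}\times\{0\}$ is identified with $\Lambda$. **Augmented space.** For a graph $\Gamma'$ and a family $(\Lambda_\alpha)_{\alpha\in\mathscr A}$ of subgraphs, the augmented space $\mathcal H(\Gamma',(\Lambda_\alpha)_\alpha)$ is obtained from $\Gamma'$ by attaching, for each $\alpha$, the horoball $\mathcal H(\Lambda_\alpha)$ along $\Lambda_\alpha=\Lambda_\alpha\times\{0\}$. The graph $\Gamma'$ is hyperbolic relative to $(\Lambda_\alpha)_\alpha$ if the augmented space is $\delta$-hyperbolic (in the sense of Gromov) for some $\delta$. **Relatively hyperbolic groups.** Let $G$ be a finitely generated group and $H_1,\dots,H_k$ finitely generated subgroups. Let $S_i$ be a finite generating set of $H_i$ and $S$ a finite generating set of $G$ containing every $S_i$. Let $\Gamma'=\mathrm{Cay}(G,S)$ and, for $g\in G$, let $g\Lambda_i$ be the subgraph of $\Gamma'$ with vertex set $gH_i$ and edges those joining $gh$ to $ghs$ with $h\in H_i$, $s\in S_i$. Then $G$ is hyperbolic relative to $\{H_1,\dots,H_k\}$ if $\Gamma'$ is hyperbolic relative to the set of subgraphs $\{g\Lambda_i\}_{1\le i\le k,\ g\in G}$ (each subgraph occurring once). This is equivalent to the usual notion of (strong) relative hyperbolicity and does not depend on the choice of generating sets.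
   Formalization: If a subgroup is repeated in the family (H_i = H_j), the same generating set S_i = S_j is required; this is automatic for distinct H_i, and without it the claim fails, e.g. for G = H_1 = H_2 = Z^2 with S_1 = {e1,e2}, S_2 = {e1,e2,e1+e2}. *)

theory Defs
  imports
    Complex_Main
    "HOL-Library.Extended_Nat"
    "HOL-Algebra.Group_Action"
    "HOL-Algebra.Generated_Groups"
begin

section \<open>Graphs\<close>

text \<open>Graphs are simple: an edge is an unordered pair of distinct vertices. Loops and multiple
  edges (as from a generator \<open>1\<close>, or from \<open>s\<close> and \<open>s\<^sup>-\<^sup>1\<close>, in a Cayley graph) are suppressed;
  they do not affect the path metric.\<close>

record 'v ugraph =
  gverts :: "'v set"
  gedges :: "'v set set"

definition is_graph :: "'v ugraph \<Rightarrow> bool" where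
  "is_graph \<Gamma> \<longleftrightarrow> (\<forall>e\<in>gedges \<Gamma>. e \<subseteq> gverts \<Gamma> \<and> card e = 2)"

definition walk :: "'v ugraph \<Rightarrow> 'v \<Rightarrow> 'v list \<Rightarrow> 'v \<Rightarrow> bool" where
  "walk \<Gamma> u p v \<longleftrightarrow> p \<noteq> [] \<and> hd p = u \<and> last p = v \<and> set p \<subseteq> gverts \<Gamma> \<and>
     successively (\<lambda>x y. {x, y} \<in> gedges \<Gamma>) p"

definition connected_graph :: "'v ugraph \<Rightarrow> bool" where
  "connected_graph \<Gamma> \<longleftrightarrow> is_graph \<Gamma> \<and> gverts \<Gamma> \<noteq> {} \<and>
     (\<forall>u\<in>gverts \<Gamma>. \<forall>v\<in>gverts \<Gamma>. \<exists>p. walk \<Gamma> u p v)"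

text \<open>The path metric on vertices; it is \<open>\<infinity>\<close> between different components. A walk is given by
  its list of vertices, so its length is one less than the length of the list.\<close>

definition gdist :: "'v ugraph \<Rightarrow> 'v \<Rightarrow> 'v \<Rightarrow> enat" where
  "gdist \<Gamma> u v = (INF p\<in>{p. walk \<Gamma> u p v}. enat (length p - 1))"

definition is_subgraph :: "'v ugraph \<Rightarrow> 'v ugraph \<Rightarrow> bool" where
  "is_subgraph \<Delta> \<Gamma> \<longleftrightarrow> is_graph \<Delta> \<and> gverts \<Delta> \<subseteq> gverts \<Gamma> \<and> gedges \<Delta> \<subseteq> gedges \<Gamma>"

definition graph_isomorphic :: "'v ugraph \<Rightarrow> 'w ugraph \<Rightarrow> bool" where
  "graph_isomorphic \<Gamma> \<Delta> \<longleftrightarrow>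
     (\<exists>f. bij_betw f (gverts \<Gamma>) (gverts \<Delta>) \<and> (\<lambda>e. f ` e) ` gedges \<Gamma> = gedges \<Delta>)"

definition rips_graph :: "nat \<Rightarrow> 'v ugraph \<Rightarrow> 'v ugraph" where
  "rips_graph k \<Lambda> = \<lparr>gverts = gverts \<Lambda>,
     gedges = {{u, v} | u v. u \<in> gverts \<Lambda> \<and> v \<in> gverts \<Lambda> \<and> u \<noteq> v \<and> gdist \<Lambda> u v \<le> enat k}\<rparr>"


section \<open>Connected graphs as geodesic metric spaces\<close>

text \<open>A point of the geometric realization is given by its barycentric coordinates: a
  vertex \<open>u\<close> is the indicator function of \<open>u\<close>, and the point at distance \<open>t\<close> from \<open>u\<close> on the
  edge \<open>{u, v}\<close> has the coordinates \<open>1 - t\<close> at \<open>u\<close> and \<open>t\<close> at \<open>v\<close>.\<close>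

definition point_support :: "('v \<Rightarrow> real) \<Rightarrow> 'v set" where
  "point_support p = {v. p v \<noteq> 0}"

definition realization :: "'v ugraph \<Rightarrow> ('v \<Rightarrow> real) set" where
  "realization \<Gamma> = {p. (\<forall>v. 0 \<le> p v) \<and>
     ((\<exists>v\<in>gverts \<Gamma>. point_support p = {v}) \<or> point_support p \<in> gedges \<Gamma>) \<and>
     (\<Sum>v\<in>point_support p. p v) = 1}"

text \<open>The path metric of the realization, every edge being isometric to the unit interval. The
  first case is that of two points on a common edge; otherwise a shortest path
  from \<open>p\<close> to \<open>q\<close> leaves the edge of \<open>p\<close> through an end vertex \<open>a\<close>, at distance \<open>1 - p a\<close>
  from \<open>p\<close>, and reaches the edge of \<open>q\<close> through an end vertex \<open>b\<close>. Meaningful for connected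
  graphs only.\<close>

definition rdist :: "'v ugraph \<Rightarrow> ('v \<Rightarrow> real) \<Rightarrow> ('v \<Rightarrow> real) \<Rightarrow> real" where
  "rdist \<Gamma> p q =
     (if \<exists>e\<in>gedges \<Gamma>. point_support p \<union> point_support q \<subseteq> e
      then (\<Sum>v\<in>point_support p \<union> point_support q. \<bar>p v - q v\<bar>) / 2
      else Min {(1 - p a) + real (the_enat (gdist \<Gamma> a b)) + (1 - q b) | a b.
                  a \<in> point_support p \<and> b \<in> point_support q})"

definition gromov_product :: "('p \<Rightarrow> 'p \<Rightarrow> real) \<Rightarrow> 'p \<Rightarrow> 'p \<Rightarrow> 'p \<Rightarrow> real" where
  "gromov_product d w x y = (d x w + d y w - d x y) / 2"

definition gromov_hyperbolic :: "real \<Rightarrow> 'p set \<Rightarrow> ('p \<Rightarrow> 'p \<Rightarrow> real) \<Rightarrow> bool" where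
  "gromov_hyperbolic \<delta> X d \<longleftrightarrow> (\<forall>w\<in>X. \<forall>x\<in>X. \<forall>y\<in>X. \<forall>z\<in>X.
     gromov_product d w x z \<ge> min (gromov_product d w x y) (gromov_product d w y z) - \<delta>)"

definition hyperbolic_graph :: "'v ugraph \<Rightarrow> bool" where
  "hyperbolic_graph \<Gamma> \<longleftrightarrow> (\<exists>\<delta>. gromov_hyperbolic \<delta> (realization \<Gamma>) (rdist \<Gamma>))"

definition graph_geodesic :: "'v ugraph \<Rightarrow> real \<Rightarrow> (real \<Rightarrow> 'v \<Rightarrow> real) \<Rightarrow> bool" where
  "graph_geodesic \<Gamma> l c \<longleftrightarrow> 0 \<le> l \<and> c ` {0..l} \<subseteq> realization \<Gamma> \<and>
     (\<forall>s\<in>{0..l}. \<forall>t\<in>{0..l}. rdist \<Gamma> (c s) (c t) = \<bar>s - t\<bar>)"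

definition convex_subgraph :: "'v ugraph \<Rightarrow> 'v ugraph \<Rightarrow> bool" where
  "convex_subgraph \<Delta> \<Gamma> \<longleftrightarrow> is_subgraph \<Delta> \<Gamma> \<and>
     (\<forall>l c. graph_geodesic \<Gamma> l c \<and> c 0 \<in> realization \<Delta> \<and> c l \<in> realization \<Delta> \<longrightarrow>
        c ` {0..l} \<subseteq> realization \<Delta>)"


section \<open>Horoballs and relatively hyperbolic graphs\<close>

definition horoball :: "'v ugraph \<Rightarrow> ('v \<times> nat) ugraph" where
  "horoball \<Lambda> = \<lparr>gverts = gverts \<Lambda> \<times> UNIV,
     gedges = {{(v, n), (v, Suc n)} | v n. v \<in> gverts \<Lambda>} \<union>
              {{(v, n), (w, n)} | v w n. v \<in> gverts \<Lambda> \<and> w \<in> gverts \<Lambda> \<and>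
                 0 < gdist \<Lambda> v w \<and> gdist \<Lambda> v w \<le> enat (2 ^ n)}\<rparr>"

text \<open>\<open>Base v\<close> is the vertex \<open>v\<close> of the graph to which the horoballs are attached, and
  \<open>Deep \<Lambda> v n\<close> (used for \<open>n > 0\<close> only) is the vertex \<open>(v, n)\<close> of the horoball over \<open>\<Lambda>\<close>. The
  vertices \<open>(v, 0)\<close> are identified with \<open>v\<close>.\<close>

datatype 'v aug_vertex = Base 'v | Deep "'v ugraph" 'v nat

definition attach :: "'v ugraph \<Rightarrow> 'v \<times> nat \<Rightarrow> 'v aug_vertex" where
  "attach \<Lambda> = (\<lambda>(v, n). if n = 0 then Base v else Deep \<Lambda> v n)"

text \<open>The family of subgraphs is a set, so that each subgraph occurs once.\<close>

definition augmented_space :: "'v ugraph \<Rightarrow> 'v ugraph set \<Rightarrow> 'v aug_vertex ugraph" where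
  "augmented_space \<Gamma>' \<L> = \<lparr>
     gverts = Base ` gverts \<Gamma>' \<union> (\<Union>\<Lambda>\<in>\<L>. attach \<Lambda> ` gverts (horoball \<Lambda>)),
     gedges = (\<lambda>e. Base ` e) ` gedges \<Gamma>' \<union>
              (\<Union>\<Lambda>\<in>\<L>. (\<lambda>e. attach \<Lambda> ` e) ` gedges (horoball \<Lambda>))\<rparr>"

definition rel_hyperbolic_graph :: "'v ugraph \<Rightarrow> 'v ugraph set \<Rightarrow> bool" where
  "rel_hyperbolic_graph \<Gamma>' \<L> \<longleftrightarrow> hyperbolic_graph (augmented_space \<Gamma>' \<L>)"


section \<open>Relatively hyperbolic groups\<close>

definition finite_generating_set :: "('g, 'b) monoid_scheme \<Rightarrow> 'g set \<Rightarrow> 'g set \<Rightarrow> bool" where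
  "finite_generating_set G H T \<longleftrightarrow> finite T \<and> T \<subseteq> H \<and> generate G T = H"

definition finitely_generated :: "('g, 'b) monoid_scheme \<Rightarrow> 'g set \<Rightarrow> bool" where
  "finitely_generated G H \<longleftrightarrow> (\<exists>T. finite_generating_set G H T)"

definition coset_graph ::
  "('g, 'b) monoid_scheme \<Rightarrow> 'g \<Rightarrow> 'g set \<Rightarrow> 'g set \<Rightarrow> 'g ugraph" where
  "coset_graph G g H T = \<lparr>gverts = g <#\<^bsub>G\<^esub> H,
     gedges = {{g \<otimes>\<^bsub>G\<^esub> h, g \<otimes>\<^bsub>G\<^esub> h \<otimes>\<^bsub>G\<^esub> s} | h s. h \<in> H \<and> s \<in> T \<and> s \<noteq> \<one>\<^bsub>G\<^esub>}\<rparr>"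

definition cayley_graph :: "('g, 'b) monoid_scheme \<Rightarrow> 'g set \<Rightarrow> 'g ugraph" where
  "cayley_graph G T = \<lparr>gverts = carrier G,
     gedges = {{g, g \<otimes>\<^bsub>G\<^esub> s} | g s. g \<in> carrier G \<and> s \<in> T \<and> s \<noteq> \<one>\<^bsub>G\<^esub>}\<rparr>"

text \<open>The property does not depend on the choice of the generating sets \<open>T i\<close> and \<open>S\<close> (for
  pairwise distinct subgroups \<open>H i\<close>), so we ask for it for some choice.\<close>

definition rel_hyperbolic_group ::
  "('g, 'b) monoid_scheme \<Rightarrow> 'i set \<Rightarrow> ('i \<Rightarrow> 'g set) \<Rightarrow> bool" where
  "rel_hyperbolic_group G I H \<longleftrightarrow>
     (\<exists>T S. (\<forall>i\<in>I. finite_generating_set G (H i) (T i) \<and> T i \<subseteq> S) \<and>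
        finite_generating_set G (carrier G) S \<and>
        rel_hyperbolic_graph (cayley_graph G S)
          {coset_graph G g (H i) (T i) | g i. g \<in> carrier G \<and> i \<in> I})"


section \<open>Actions on graphs\<close>

definition graph_action ::
  "('g, 'b) monoid_scheme \<Rightarrow> 'v ugraph \<Rightarrow> ('g \<Rightarrow> 'v \<Rightarrow> 'v) \<Rightarrow> bool" where
  "graph_action G \<Gamma> \<phi> \<longleftrightarrow> group_action G (gverts \<Gamma>) \<phi> \<and>
     (\<forall>g\<in>carrier G. (\<lambda>e. \<phi> g ` e) ` gedges \<Gamma> = gedges \<Gamma>)"

definition stabilizes :: "'g set \<Rightarrow> ('g \<Rightarrow> 'v \<Rightarrow> 'v) \<Rightarrow> 'v ugraph \<Rightarrow> bool" where
  "stabilizes H \<phi> \<Delta> \<longleftrightarrow>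
     (\<forall>h\<in>H. \<phi> h ` gverts \<Delta> = gverts \<Delta> \<and> (\<lambda>e. \<phi> h ` e) ` gedges \<Delta> = gedges \<Delta>)"

text \<open>The following two notions also apply to the action on a stabilized subgraph of a
  subgroup \<open>H\<close>, regarded as the group \<open>G\<lparr>carrier := H\<rparr>\<close>.\<close>

definition free_action ::
  "('g, 'b) monoid_scheme \<Rightarrow> 'v ugraph \<Rightarrow> ('g \<Rightarrow> 'v \<Rightarrow> 'v) \<Rightarrow> bool" where
  "free_action G \<Gamma> \<phi> \<longleftrightarrow> (\<forall>v\<in>gverts \<Gamma>. stabilizer G \<phi> v = {\<one>\<^bsub>G\<^esub>})"

definition cocompact_action ::
  "('g, 'b) monoid_scheme \<Rightarrow> 'v ugraph \<Rightarrow> ('g \<Rightarrow> 'v \<Rightarrow> 'v) \<Rightarrow> bool" where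
  "cocompact_action G \<Gamma> \<phi> \<longleftrightarrow>
     finite (orbits G (gverts \<Gamma>) \<phi>) \<and> finite (orbits G (gedges \<Gamma>) (\<lambda>g e. \<phi> g ` e))"

text \<open>A free \<open>G\<close>-set with finitely many orbits is isomorphic to \<open>G \<times> {0..<m}\<close> for some \<open>m\<close>.
  Hence nothing is lost by taking the vertices of a graph with a free cocompact action
  of \<open>G\<close> from the type \<open>'g \<times> nat\<close>, where \<open>'g\<close> is the type of the elements of \<open>G\<close>.\<close>

end

theory Submission
  imports Defs
begin

text \<open>Replacing every coset graph \<open>g \<Lambda>\<^sub>i\<close> in a Cayley graph of \<open>G\<close> by its Rips graph of a large
  parameter \<open>k\<close> does it. The nearest-point projection of \<open>G\<close> to \<open>H\<^sub>i\<close> in the augmented space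
  moves adjacent vertices, and any two vertices of another coset, to points at bounded distance:
  for a vertex \<open>w\<close> deep in the horoball over \<open>H\<^sub>i\<close> and a vertex \<open>x\<close> outside it, \<open>d x w\<close> equals
  \<open>d x H\<^sub>i\<close> plus the depth of \<open>w\<close> up to an error of 1, so the four-point condition with \<open>w\<close> as one of
  the points gives the usual contraction estimates without any geodesics. With \<open>k\<close> at least twice
  the resulting bound for the word metric of \<open>H\<^sub>i\<close>, every path that leaves \<open>H\<^sub>i\<close> can be shortened:
  the two edges at a vertex outside \<open>H\<^sub>i\<close> project to points of \<open>H\<^sub>i\<close> at distance at most \<open>k\<close>.\<close>

section \<open>The path metric\<close>

text \<open>The order of choices keeps the argument from being circular: enlarging \<open>k\<close>
  adds edges, and the bound on their projections must not grow with \<open>k\<close>. It does not,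
  because hyperbolicity is applied once, to the augmented space over the original Cayley graph, and
  an added edge lies either inside \<open>H i\<close> or inside another coset, all of whose vertices
  project to a set of diameter at most \<open>B\<close>. So \<open>B\<close> comes first and
  \<open>k\<close> afterwards. Between them stands a change of metric: \<open>B\<close> refers to
  the word metric of \<open>G\<close>, Rips edges to that of \<open>H i\<close> for
  \<open>S i\<close>. Finiteness of balls in \<open>G\<close> gives the conversion. The resulting
  graph is again a Cayley graph, for \<open>S\<^sub>0\<close> together with the
  \<open>k\<close>-balls of all \<open>H j\<close>, so the action is left multiplication. Equal
  subgroups carry equal generating sets; otherwise the ball of one could add edges inside the other
  that are not Rips edges there.\<close>

lemma walk_Cons_Cons:
  "walk \<Gamma> u (x # y # p) v \<longleftrightarrow>
     x = u \<and> u \<in> gverts \<Gamma> \<and> {u, y} \<in> gedges \<Gamma> \<and> walk \<Gamma> y (y # p) v"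
  unfolding walk_def by auto

lemma walk_singleton: "walk \<Gamma> u [x] v \<longleftrightarrow> x = u \<and> u = v \<and> u \<in> gverts \<Gamma>"
  unfolding walk_def by auto

lemma walk_hd_in: "walk \<Gamma> u p v \<Longrightarrow> u \<in> gverts \<Gamma>"
  unfolding walk_def by (metis hd_in_set subsetD)

lemma walk_rev: "walk \<Gamma> u p v \<Longrightarrow> walk \<Gamma> v (rev p) u"
  unfolding walk_def by (auto simp: hd_rev last_rev insert_commute)

lemma walk_append:
  assumes "walk \<Gamma> u p v" "walk \<Gamma> v q w"
  shows "walk \<Gamma> u (p @ tl q) w"
proof -
  obtain q' where q: "q = v # q'"
    using assms(2) unfolding walk_def by (metis list.collapse)
  show ?thesis
    using assms unfolding q walk_def
    by (cases q') (auto simp: successively_append_iff)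
qed

lemma gdist_le_walk: "walk \<Gamma> u p v \<Longrightarrow> gdist \<Gamma> u v \<le> enat (length p - 1)"
  unfolding gdist_def by (rule INF_lower) simp

text \<open>The infimum over an empty set of walks is \<infinity>, so finiteness supplies a walk,
  and in the well-ordered type \<open>enat\<close> the infimum of a nonempty set is
  attained.\<close>

lemma shortest_walk:
  assumes "gdist \<Gamma> u v \<noteq> \<infinity>"
  obtains p where "walk \<Gamma> u p v" "gdist \<Gamma> u v = enat (length p - 1)"
proof -
  let ?A = "(\<lambda>p. enat (length p - 1)) ` {p. walk \<Gamma> u p v}"
  have "?A \<noteq> {}"
    using assms unfolding gdist_def unfolding top_enat_def[symmetric] by (metis Inf_empty)
  then have "Inf ?A \<in> ?A"
    unfolding Inf_enat_def by (auto intro: LeastI)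
  then show thesis
    using that unfolding gdist_def by auto
qed

lemma gdist_finite:
  assumes "connected_graph \<Gamma>" "u \<in> gverts \<Gamma>" "v \<in> gverts \<Gamma>"
  shows "gdist \<Gamma> u v \<noteq> \<infinity>"
proof -
  obtain p where "walk \<Gamma> u p v"
    using assms unfolding connected_graph_def by blast
  from gdist_le_walk[OF this] show ?thesis
    by (metis enat_ord_code(5) infinity_ileE)
qed

lemma gdist_triangle: "gdist \<Gamma> u w \<le> gdist \<Gamma> u v + gdist \<Gamma> v w"
proof (cases "gdist \<Gamma> u v = \<infinity> \<or> gdist \<Gamma> v w = \<infinity>")
  case False
  then obtain p q where "walk \<Gamma> u p v" "gdist \<Gamma> u v = enat (length p - 1)"
    "walk \<Gamma> v q w" "gdist \<Gamma> v w = enat (length q - 1)"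
    by (metis shortest_walk)
  moreover from this have "gdist \<Gamma> u w \<le> enat (length (p @ tl q) - 1)" "p \<noteq> []" "q \<noteq> []"
    using gdist_le_walk[OF walk_append[of \<Gamma> u p v q w]] by (auto simp: walk_def)
  ultimately show ?thesis
    by (cases p; cases q) auto
qed auto

lemma gdist_le_imp_finite: "gdist \<Gamma> u v \<le> enat n \<Longrightarrow> gdist \<Gamma> u v \<noteq> \<infinity>"
  by (metis enat_ord_code(5) infinity_ileE)

lemma gdist_triangle_le:
  assumes "gdist \<Gamma> u v \<le> enat m" "gdist \<Gamma> v w \<le> enat n"
  shows "gdist \<Gamma> u w \<le> enat (m + n)"
  using order_trans[OF gdist_triangle[of \<Gamma> u w v] add_mono[OF assms]] by simp

lemma gdist_commute: "gdist \<Gamma> u v = gdist \<Gamma> v u"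
proof -
  have "gdist \<Gamma> u v \<le> gdist \<Gamma> v u" for u v
  proof (cases "gdist \<Gamma> v u = \<infinity>")
    case False
    then obtain p where "walk \<Gamma> v p u" "gdist \<Gamma> v u = enat (length p - 1)"
      by (rule shortest_walk)
    then show ?thesis using gdist_le_walk[OF walk_rev] by simp
  qed simp
  then show ?thesis by (meson order_antisym)
qed

lemma gdist_refl: "u \<in> gverts \<Gamma> \<Longrightarrow> gdist \<Gamma> u u = 0"
  using gdist_le_walk[of \<Gamma> u "[u]" u] by (simp add: walk_singleton flip: zero_enat_def)

lemma gdist_eq_0D: "gdist \<Gamma> u v = 0 \<Longrightarrow> u = v"
  by (rule shortest_walk[of \<Gamma> u v]) (auto simp: zero_enat_def walk_def neq_Nil_conv)

lemma edge_in:
  assumes "is_graph \<Gamma>" "{u, v} \<in> gedges \<Gamma>"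
  shows "u \<in> gverts \<Gamma>" "v \<in> gverts \<Gamma>" "u \<noteq> v"
  using assms unfolding is_graph_def by fastforce+

lemma edge_obtain:
  assumes "is_graph \<Gamma>" "e \<in> gedges \<Gamma>"
  obtains u v where "e = {u, v}" "u \<noteq> v"
  using assms unfolding is_graph_def by (metis card_2_iff)

lemma gdist_edge:
  assumes "is_graph \<Gamma>" "{u, v} \<in> gedges \<Gamma>"
  shows "gdist \<Gamma> u v \<le> 1"
  using gdist_le_walk[of \<Gamma> u "[u, v]" v] edge_in[OF assms] assms
  by (simp add: walk_Cons_Cons walk_singleton one_enat_def)

lemma gdist_edge_eq:
  assumes "is_graph \<Gamma>" "{u, v} \<in> gedges \<Gamma>"
  shows "gdist \<Gamma> u v = 1"
proof (rule order_antisym)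
  show "1 \<le> gdist \<Gamma> u v"
    using gdist_eq_0D[of \<Gamma> u v] edge_in(3)[OF assms] by (metis Suc_ile_eq One_nat_def one_enat_def zero_enat_def gr_zeroI)
qed (rule gdist_edge[OF assms])

text \<open>The map \<open>f\<close> need not send edges to edges: a bound per edge adds up along
  the walk. This covers inclusions, left translations and the projections to cosets alike.\<close>

lemma gdist_map_walk:
  assumes "\<And>x. x \<in> gverts \<Gamma> \<Longrightarrow> f x \<in> gverts \<Delta>"
    and "\<And>x y. {x, y} \<in> gedges \<Gamma> \<Longrightarrow> gdist \<Delta> (f x) (f y) \<le> enat c"
    and "walk \<Gamma> u p v"
  shows "gdist \<Delta> (f u) (f v) \<le> enat (c * (length p - 1))"
  using assms(3)
proof (induction p arbitrary: u rule: induct_list012)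
  case (2 x)
  then show ?case using assms(1) by (auto simp: walk_singleton gdist_refl)
next
  case (3 x y zs)
  then have "gdist \<Delta> (f y) (f v) \<le> enat (c * length zs)" "gdist \<Delta> (f u) (f y) \<le> enat c"
    using assms(2) by (auto simp: walk_Cons_Cons)
  then show ?case
    using gdist_triangle[of \<Delta> "f u" "f v" "f y"] add_mono[of _ "enat c" _ "enat (c * length zs)"]
    by (metis (no_types, lifting) diff_Suc_1 length_Cons mult_Suc_right order_trans plus_enat_simps(1))
qed (simp add: walk_def)

lemma gdist_map:
  assumes "\<And>x. x \<in> gverts \<Gamma> \<Longrightarrow> f x \<in> gverts \<Delta>"
    and "\<And>x y. {x, y} \<in> gedges \<Gamma> \<Longrightarrow> gdist \<Delta> (f x) (f y) \<le> enat c"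
    and "gdist \<Gamma> u v \<le> enat n"
  shows "gdist \<Delta> (f u) (f v) \<le> enat (c * n)"
proof -
  obtain p where p: "walk \<Gamma> u p v" "gdist \<Gamma> u v = enat (length p - 1)"
    using assms(3) by (metis shortest_walk enat_ord_simps(5) infinity_ileE)
  have "gdist \<Delta> (f u) (f v) \<le> enat (c * (length p - 1))"
    by (rule gdist_map_walk[OF assms(1,2) p(1)])
  also have "\<dots> \<le> enat (c * n)"
    using p(2) assms(3) by simp
  finally show ?thesis .
qed

lemma connected_graph_gdist:
  assumes "is_graph \<Gamma>" "r \<in> gverts \<Gamma>" "\<And>v. v \<in> gverts \<Gamma> \<Longrightarrow> gdist \<Gamma> r v \<noteq> \<infinity>"
  shows "connected_graph \<Gamma>"
proof -
  have "\<exists>p. walk \<Gamma> u p v" if uv: "u \<in> gverts \<Gamma>" "v \<in> gverts \<Gamma>" for u v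
  proof -
    obtain p q where "walk \<Gamma> r p u" "walk \<Gamma> r q v"
      by (rule shortest_walk[OF assms(3)[OF uv(1)]], rule shortest_walk[OF assms(3)[OF uv(2)]]) blast
    then have "walk \<Gamma> u (rev p @ tl q) v" by (intro walk_append walk_rev)
    then show ?thesis ..
  qed
  then show ?thesis
    using assms unfolding connected_graph_def by auto
qed

text \<open>The same expression that occurs in \<open>rdist\<close>, with real values so that linear
  arithmetic applies. It is meaningful where \<open>gdist\<close> is finite, hence in connected
  graphs.\<close>

definition vdist :: "'v ugraph \<Rightarrow> 'v \<Rightarrow> 'v \<Rightarrow> real" where
  "vdist \<Gamma> u v = real (the_enat (gdist \<Gamma> u v))"

lemma vdist_nonneg [simp]: "0 \<le> vdist \<Gamma> u v"
  by (simp add: vdist_def)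

lemma vdist_commute: "vdist \<Gamma> u v = vdist \<Gamma> v u"
  by (simp add: vdist_def gdist_commute)

lemma vdist_refl: "u \<in> gverts \<Gamma> \<Longrightarrow> vdist \<Gamma> u u = 0"
  by (simp add: vdist_def gdist_refl zero_enat_def)

lemma vdist_edge_eq: "is_graph \<Gamma> \<Longrightarrow> {u, v} \<in> gedges \<Gamma> \<Longrightarrow> vdist \<Gamma> u v = 1"
  by (simp add: vdist_def gdist_edge_eq one_enat_def)

context
  fixes \<Gamma> :: "'v ugraph"
  assumes conn: "connected_graph \<Gamma>"
begin

lemma graph_if_connected: "is_graph \<Gamma>"
  using conn by (simp add: connected_graph_def)

lemma gdist_le_iff_vdist:
  assumes "u \<in> gverts \<Gamma>" "v \<in> gverts \<Gamma>"
  shows "gdist \<Gamma> u v \<le> enat n \<longleftrightarrow> vdist \<Gamma> u v \<le> real n"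
  using gdist_finite[OF conn assms] by (auto simp: vdist_def)

lemma vdist_triangle:
  assumes "u \<in> gverts \<Gamma>" "v \<in> gverts \<Gamma>" "w \<in> gverts \<Gamma>"
  shows "vdist \<Gamma> u w \<le> vdist \<Gamma> u v + vdist \<Gamma> v w"
proof -
  obtain a b c where "gdist \<Gamma> u v = enat a" "gdist \<Gamma> v w = enat b" "gdist \<Gamma> u w = enat c"
    using gdist_finite[OF conn] assms by (metis not_infinity_eq)
  then show ?thesis
    using gdist_triangle[of \<Gamma> u w v] by (simp add: vdist_def)
qed

text \<open>The source of all lower bounds on distances: \<open>f\<close> will be the depth or a
  Busemann-like function. The one-sided bound on edges is two-sided in effect, as
  \<open>{x, y} = {y, x}\<close>.\<close>

lemma vdist_lipschitz:
  fixes f :: "'v \<Rightarrow> real"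
  assumes "\<And>x y. {x, y} \<in> gedges \<Gamma> \<Longrightarrow> f x - f y \<le> 1"
    and "u \<in> gverts \<Gamma>" "v \<in> gverts \<Gamma>"
  shows "f u - f v \<le> vdist \<Gamma> u v"
proof -
  have "f u - f v \<le> real (length p - 1)" if "walk \<Gamma> u p v" for p u
    using that
  proof (induction p arbitrary: u rule: induct_list012)
    case (3 x y zs)
    then have "f u - f y \<le> 1" "f y - f v \<le> real (length (y # zs) - 1)"
      using assms(1)[of u y] by (simp_all only: walk_Cons_Cons)
    then show ?case by simp
  qed (auto simp: walk_def)
  moreover obtain p where "walk \<Gamma> u p v" "gdist \<Gamma> u v = enat (length p - 1)"
    by (rule shortest_walk[OF gdist_finite[OF conn assms(2,3)]])
  ultimately show ?thesis by (simp add: vdist_def)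
qed

end

section \<open>Convexity in the geometric realization\<close>

lemma realization_support_sum:
  assumes "p \<in> realization \<Gamma>" "point_support p \<subseteq> e" "finite e"
  shows "sum p e = 1"
proof -
  have "sum p (point_support p) = sum p e"
    by (rule sum.mono_neutral_left) (use assms in \<open>auto simp: point_support_def\<close>)
  then show ?thesis
    using assms(1) by (simp add: realization_def)
qed

lemma realization_nonneg: "p \<in> realization \<Gamma> \<Longrightarrow> 0 \<le> p v"
  by (simp add: realization_def)

lemma realization_support:
  assumes "is_graph \<Gamma>" "p \<in> realization \<Gamma>"
  shows "finite (point_support p)" "point_support p \<noteq> {}" "point_support p \<subseteq> gverts \<Gamma>"
    "p v \<le> 1"
proof -
  have *: "card (point_support p) \<noteq> 0" and 3: "point_support p \<subseteq> gverts \<Gamma>"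
    using assms unfolding realization_def is_graph_def by fastforce+
  then show 1: "finite (point_support p)" and "point_support p \<noteq> {}"
    "point_support p \<subseteq> gverts \<Gamma>"
    by (auto intro: card_ge_0_finite)
  show "p v \<le> 1"
  proof (cases "v \<in> point_support p")
    case True
    then show ?thesis
      using member_le_sum[of v "point_support p" p] 1 assms(2) by (auto simp: realization_def)
  qed (simp add: point_support_def)
qed

text \<open>The two coordinates on an edge sum to 1, so both absolute differences are equal and the
  factor 1/2 in \<open>rdist\<close> leaves one of them.\<close>

lemma rdist_common_edge:
  assumes "is_graph \<Gamma>" "p \<in> realization \<Gamma>" "q \<in> realization \<Gamma>"
    and "{u, v} \<in> gedges \<Gamma>" "point_support p \<union> point_support q \<subseteq> {u, v}"
  shows "rdist \<Gamma> p q = \<bar>p u - q u\<bar>" "p u + p v = 1" "q u + q v = 1"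
proof -
  have "u \<noteq> v" using edge_in[OF assms(1,4)] by blast
  then show p: "p u + p v = 1" and q: "q u + q v = 1"
    using realization_support_sum[of _ \<Gamma> "{u, v}"] assms by auto
  have "(\<Sum>v\<in>point_support p \<union> point_support q. \<bar>p v - q v\<bar>) = (\<Sum>v\<in>{u, v}. \<bar>p v - q v\<bar>)"
    by (rule sum.mono_neutral_left) (use assms in \<open>auto simp: point_support_def\<close>)
  then have "rdist \<Gamma> p q = (\<bar>p u - q u\<bar> + \<bar>p v - q v\<bar>) / 2"
    using assms(4,5) \<open>u \<noteq> v\<close> unfolding rdist_def by auto
  then show "rdist \<Gamma> p q = \<bar>p u - q u\<bar>"
  proof -
    have "p v - q v = - (p u - q u)" using p q by linarith
    then show ?thesis using \<open>rdist \<Gamma> p q = _\<close> by simp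
  qed
qed

lemma rdist_far:
  assumes "is_graph \<Gamma>" "p \<in> realization \<Gamma>" "q \<in> realization \<Gamma>"
    and "\<not> (\<exists>e\<in>gedges \<Gamma>. point_support p \<union> point_support q \<subseteq> e)"
  shows "\<lbrakk>a \<in> point_support p; b \<in> point_support q\<rbrakk> \<Longrightarrow>
      rdist \<Gamma> p q \<le> (1 - p a) + vdist \<Gamma> a b + (1 - q b)"
    and "\<exists>a\<in>point_support p. \<exists>b\<in>point_support q.
      rdist \<Gamma> p q = (1 - p a) + vdist \<Gamma> a b + (1 - q b)"
proof -
  let ?M = "{(1 - p a) + vdist \<Gamma> a b + (1 - q b) | a b. a \<in> point_support p \<and> b \<in> point_support q}"
  have eq: "rdist \<Gamma> p q = Min ?M"
    using assms(4) unfolding rdist_def vdist_def by (simp only: if_False)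
  have "?M = (\<lambda>(a, b). (1 - p a) + vdist \<Gamma> a b + (1 - q b)) ` (point_support p \<times> point_support q)"
    by auto
  then have M: "finite ?M" "?M \<noteq> {}"
    using realization_support[OF assms(1)] assms(2,3) by auto
  show "rdist \<Gamma> p q \<le> (1 - p a) + vdist \<Gamma> a b + (1 - q b)"
    if "a \<in> point_support p" "b \<in> point_support q"
    unfolding eq by (rule Min_le[OF M(1)]) (use that in blast)
  show "\<exists>a\<in>point_support p. \<exists>b\<in>point_support q.
      rdist \<Gamma> p q = (1 - p a) + vdist \<Gamma> a b + (1 - q b)"
    using Min_in[OF M] unfolding eq by blast
qed

text \<open>For points on a common edge \<open>rdist\<close> is not defined by the minimum, so there
  the bound has to be checked for each of the four choices of end vertices.\<close>

lemma rdist_le: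
  assumes "is_graph \<Gamma>" "p \<in> realization \<Gamma>" "q \<in> realization \<Gamma>"
    and "a \<in> point_support p" "b \<in> point_support q"
  shows "rdist \<Gamma> p q \<le> (1 - p a) + vdist \<Gamma> a b + (1 - q b)"
proof (cases "\<exists>e\<in>gedges \<Gamma>. point_support p \<union> point_support q \<subseteq> e")
  case True
  then obtain u v where e: "{u, v} \<in> gedges \<Gamma>" "point_support p \<union> point_support q \<subseteq> {u, v}"
    using edge_obtain[OF assms(1)] by metis
  note * = rdist_common_edge[OF assms(1-3) e]
  have "p u \<ge> 0" "p v \<ge> 0" "q u \<ge> 0" "q v \<ge> 0"
    using realization_nonneg[OF assms(2)] realization_nonneg[OF assms(3)] by auto
  moreover have "{v, u} \<in> gedges \<Gamma>"
    using e by (simp add: insert_commute)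
  then have "vdist \<Gamma> u v = 1" "vdist \<Gamma> v u = 1"
    using e vdist_edge_eq[OF assms(1)] by auto
  moreover have "a = u \<or> a = v" "b = u \<or> b = v"
    using e assms(4,5) by auto
  ultimately show ?thesis
    using * vdist_nonneg[of \<Gamma> u u] vdist_nonneg[of \<Gamma> v v] by (elim disjE; hypsubst; linarith)
qed (use rdist_far assms in metis)

lemma rdist_commute:
  "rdist \<Gamma> p q = rdist \<Gamma> q p"
proof -
  have "{(1 - p a) + real (the_enat (gdist \<Gamma> a b)) + (1 - q b) | a b.
          a \<in> point_support p \<and> b \<in> point_support q} =
        {(1 - q a) + real (the_enat (gdist \<Gamma> a b)) + (1 - p b) | a b.
          a \<in> point_support q \<and> b \<in> point_support p}"
    by (force simp: gdist_commute algebra_simps)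
  then show ?thesis
    unfolding rdist_def by (simp only: Un_commute abs_minus_commute[of "p _"])
qed

text \<open>The formula through end vertices survives the common-edge case: an interior point
  \<open>p\<close> of the edge would put the edge, and with it \<open>z\<close>, into \<Delta>.
  Hence \<open>p\<close> is an end vertex, and one measures from it.\<close>

lemma rdist_from_subgraph:
  assumes "is_graph \<Gamma>" "is_subgraph \<Delta> \<Gamma>" "p \<in> realization \<Delta>" "z \<in> realization \<Gamma>"
    and "z \<notin> realization \<Delta>"
  shows "\<exists>a\<in>point_support p. \<exists>b\<in>point_support z.
    rdist \<Gamma> p z = (1 - p a) + vdist \<Gamma> a b + (1 - z b)"
proof (cases "\<exists>e\<in>gedges \<Gamma>. point_support p \<union> point_support z \<subseteq> e")
  case True
  then obtain e where e: "e \<in> gedges \<Gamma>" "point_support p \<union> point_support z \<subseteq> e" by blast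
  have p: "p \<in> realization \<Gamma>"
    using assms(2,3) unfolding realization_def is_subgraph_def by auto
  have ce: "card e = 2" using e assms(1) by (auto simp: is_graph_def)
  then have fe: "finite e" by (auto intro: card_ge_0_finite)
  have "point_support p \<noteq> e"
  proof
    assume pe: "point_support p = e"
    then have eD: "e \<in> gedges \<Delta>" "e \<subseteq> gverts \<Delta>"
      using assms(2,3) ce unfolding realization_def is_subgraph_def is_graph_def by fastforce+
    have "(\<exists>v\<in>gverts \<Gamma>. point_support z = {v}) \<or> point_support z = e"
      using assms(1,4) e ce card_subset_eq[OF fe, of "point_support z"]
      unfolding realization_def is_graph_def by auto
    then have "z \<in> realization \<Delta>"
      using assms(4) eD e unfolding realization_def by auto
    with assms(5) show False ..
  qed
  then obtain a where a: "point_support p = {a}"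
    using p e ce card_subset_eq[OF fe, of "point_support p"] assms(1)
    unfolding realization_def is_graph_def by auto
  then obtain c where c: "e = {a, c}" "a \<noteq> c"
    using e ce unfolding card_2_iff by (auto simp: doubleton_eq_iff)
  note * = rdist_common_edge[OF assms(1) p assms(4) e[unfolded c(1)]]
  have pa: "p a = 1"
    using realization_support_sum[OF p, of "{a}"] a by simp
  show ?thesis
  proof (cases "a \<in> point_support z")
    case True
    have "vdist \<Gamma> a a = 0"
      using e c assms(1) by (auto simp: vdist_refl is_graph_def)
    moreover have "z a \<le> 1"
      using realization_support[OF assms(1,4)] by simp
    ultimately show ?thesis
      using * pa a by (intro bexI[of _ a] bexI[OF _ True]) auto
  next
    case False
    then have z: "z a = 0" "c \<in> point_support z"
      using *(3) by (auto simp: point_support_def)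
    have "vdist \<Gamma> a c = 1" using vdist_edge_eq assms(1) e c by simp
    then show ?thesis using * pa a z(1) by (intro bexI[of _ a] bexI[OF _ z(2)]) auto
  qed
next
  case False
  have "p \<in> realization \<Gamma>"
    using assms(2,3) unfolding realization_def is_subgraph_def by auto
  then show ?thesis
    using rdist_far(2)[OF assms(1) _ assms(4) False] by blast
qed

text \<open>A point \<open>z\<close> on a geodesic between \<open>p\<close> and \<open>q\<close> outside \<open>\<Delta>\<close> is reached from both through
  end vertices of its edge, so it lies on a shortest walk between vertices of \<open>\<Delta>\<close>.\<close>

lemma convex_subgraphI:
  assumes "connected_graph \<Gamma>" "is_subgraph \<Delta> \<Gamma>"
    and geod: "\<And>u v w. \<lbrakk>u \<in> gverts \<Delta>; v \<in> gverts \<Delta>; walk \<Gamma> u w v;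
      gdist \<Gamma> u v = enat (length w - 1)\<rbrakk> \<Longrightarrow> walk \<Delta> u w v"
  shows "convex_subgraph \<Delta> \<Gamma>"
proof -
  note g = graph_if_connected[OF assms(1)]
  have sub: "gverts \<Delta> \<subseteq> gverts \<Gamma>" "is_graph \<Delta>"
    using assms(2) by (auto simp: is_subgraph_def)
  have sw: "\<exists>w. walk \<Gamma> u w v \<and> vdist \<Gamma> u v = real (length w - 1)"
    if "u \<in> gverts \<Gamma>" "v \<in> gverts \<Gamma>" for u v
    by (rule shortest_walk[OF gdist_finite[OF assms(1) that]]) (auto simp: vdist_def)
  have geod': "walk \<Delta> u w v"
    if "u \<in> gverts \<Delta>" "v \<in> gverts \<Delta>" "walk \<Gamma> u w v" "real (length w - 1) \<le> vdist \<Gamma> u v" for u v w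
  proof (rule geod)
    have "gdist \<Gamma> u v \<le> enat (length w - 1)" by (rule gdist_le_walk) fact
    then show "gdist \<Gamma> u v = enat (length w - 1)"
      using that(4) by (cases "gdist \<Gamma> u v") (auto simp: vdist_def)
  qed fact+
  have between: "z \<in> realization \<Delta>"
    if p: "p \<in> realization \<Delta>" and q: "q \<in> realization \<Delta>" and z: "z \<in> realization \<Gamma>"
      and eq: "rdist \<Gamma> p z + rdist \<Gamma> z q = rdist \<Gamma> p q" for p q z
  proof (rule ccontr)
    assume nz: "z \<notin> realization \<Delta>"
    have pq: "p \<in> realization \<Gamma>" "q \<in> realization \<Gamma>"
      using assms(2) p q unfolding realization_def is_subgraph_def by auto
    obtain a b where ab: "a \<in> point_support p" "b \<in> point_support z"
      "rdist \<Gamma> p z = (1 - p a) + vdist \<Gamma> a b + (1 - z b)"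
      using rdist_from_subgraph[OF g assms(2) p z nz] by blast
    obtain a' b' where ab': "a' \<in> point_support q" "b' \<in> point_support z"
      "rdist \<Gamma> q z = (1 - q a') + vdist \<Gamma> a' b' + (1 - z b')"
      using rdist_from_subgraph[OF g assms(2) q z nz] by blast
    have v: "a \<in> gverts \<Delta>" "a' \<in> gverts \<Delta>" "b \<in> gverts \<Gamma>" "b' \<in> gverts \<Gamma>"
      using realization_support(3)[OF sub(2) p] realization_support(3)[OF sub(2) q]
        realization_support(3)[OF g z] ab ab' by auto
    have le: "rdist \<Gamma> p q \<le> (1 - p a) + vdist \<Gamma> a a' + (1 - q a')"
      by (rule rdist_le[OF g pq ab(1) ab'(1)])
    have tri: "vdist \<Gamma> a a' \<le> vdist \<Gamma> a b + vdist \<Gamma> b a'"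
      using vdist_triangle[OF assms(1)] v sub by blast
    \<comment> \<open>Since \<open>z\<close> lies between \<open>p\<close> and \<open>q\<close>, the
      two exact distances to \<open>z\<close> add up to at most the bound \<open>le\<close>, and the
      contributions \<open>1 - p a\<close> and \<open>1 - q a'\<close> cancel.\<close>
    have key: "vdist \<Gamma> a b + (1 - z b) + (1 - z b') + vdist \<Gamma> b' a' \<le> vdist \<Gamma> a a'"
      using le ab(3) ab'(3) eq by (simp add: rdist_commute[of \<Gamma> z q] vdist_commute[of \<Gamma> a' b'])
    obtain w1 w2 where w: "walk \<Gamma> a w1 b" "vdist \<Gamma> a b = real (length w1 - 1)"
      "walk \<Gamma> b' w2 a'" "vdist \<Gamma> b' a' = real (length w2 - 1)"
      using sw v sub by (meson subsetD)
    show False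
    proof (cases "b = b'")
      case True
      \<comment> \<open>With \<open>b = b'\<close>, \<open>key\<close> and the triangle inequality
        leave \<open>2 * (1 - z b) \<le> 0\<close>: the point \<open>z\<close> is the vertex
        \<open>b\<close> itself.\<close>
      then have "z b = 1"
        using key tri realization_support(4)[OF g z, of b] by simp
      then have "(\<Sum>v\<in>point_support z - {b}. z v) = 0"
        using z ab(2) realization_support(1)[OF g z] by (simp add: sum_diff1 realization_def)
      then have "point_support z = {b}"
        using ab(2) realization_support(1)[OF g z] realization_nonneg[OF z]
        by (auto simp: sum_nonneg_eq_0_iff point_support_def)
      moreover have "walk \<Delta> a (w1 @ tl w2) a'"
      proof (rule geod')
        show "walk \<Gamma> a (w1 @ tl w2) a'" using walk_append w True by metis
        show "real (length (w1 @ tl w2) - 1) \<le> vdist \<Gamma> a a'"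
          using key w(1,2,4) True \<open>z b = 1\<close> by (auto simp: walk_def of_nat_diff Suc_le_eq)
      qed (use v in auto)
      then have "b \<in> gverts \<Delta>"
        using w(1) unfolding walk_def by (metis Un_iff last_in_set set_append subsetD)
      ultimately show False
        using nz z unfolding realization_def by auto
    next
      case False
      have "point_support z \<in> gedges \<Gamma>"
        using z ab(2) ab'(2) False unfolding realization_def by auto
      then have zb: "point_support z = {b, b'}"
        using edge_obtain[OF g] ab(2) ab'(2) False by (metis doubleton_eq_iff empty_iff insert_iff)
      then have "z b + z b' = 1"
        using z False by (simp add: realization_def)
      \<comment> \<open>The two parts of the edge cut off by \<open>z\<close> have total length 1,
        so some shortest walk from \<open>a\<close> to \<open>a'\<close> crosses the whole
        edge.\<close>
      then have key: "vdist \<Gamma> a b + 1 + vdist \<Gamma> b' a' \<le> vdist \<Gamma> a a'" using key by simp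
      have "walk \<Delta> a (w1 @ w2) a'"
      proof (rule geod')
        show "walk \<Gamma> a (w1 @ w2) a'"
          using w(1,3) \<open>point_support z \<in> gedges \<Gamma>\<close> unfolding zb walk_def
          by (auto simp: successively_append_iff)
        have "w1 \<noteq> []" "w2 \<noteq> []" using w by (auto simp: walk_def)
        then show "real (length (w1 @ w2) - 1) \<le> vdist \<Gamma> a a'"
          using key w(2,4) by (cases w1; cases w2) auto
      qed (use v in auto)
      then have "{b, b'} \<in> gedges \<Delta>"
        using w(1,3) unfolding walk_def by (auto simp: successively_append_iff)
      then show False
        using nz z zb unfolding realization_def by auto
    qed
  qed
  show ?thesis
    unfolding convex_subgraph_def
  proof (intro conjI allI impI image_subsetI)
    fix l c t
    assume c: "graph_geodesic \<Gamma> l c \<and> c 0 \<in> realization \<Delta> \<and> c l \<in> realization \<Delta>"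
      and t: "t \<in> {0..l}"
    show "c t \<in> realization \<Delta>"
    proof (rule between)
      show "rdist \<Gamma> (c 0) (c t) + rdist \<Gamma> (c t) (c l) = rdist \<Gamma> (c 0) (c l)"
        using c t unfolding graph_geodesic_def by auto
    qed (use c t in \<open>auto simp: graph_geodesic_def\<close>)
  qed (rule assms)
qed

section \<open>Augmented spaces\<close>

definition vertex_point :: "'v \<Rightarrow> 'v \<Rightarrow> real" where
  "vertex_point v = (\<lambda>x. if x = v then 1 else 0)"

lemma rdist_vertices:
  assumes "is_graph \<Gamma>" "u \<in> gverts \<Gamma>" "v \<in> gverts \<Gamma>"
  shows "vertex_point u \<in> realization \<Gamma>" "rdist \<Gamma> (vertex_point u) (vertex_point v) = vdist \<Gamma> u v"
proof -
  have supp: "point_support (vertex_point w) = {w}" for w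
    by (simp add: point_support_def vertex_point_def)
  have real: "vertex_point w \<in> realization \<Gamma>" if "w \<in> gverts \<Gamma>" for w
    using that unfolding realization_def mem_Collect_eq supp by (simp add: vertex_point_def)
  then show "vertex_point u \<in> realization \<Gamma>" using assms(2) .
  note r = real[OF assms(2)] real[OF assms(3)]
  show "rdist \<Gamma> (vertex_point u) (vertex_point v) = vdist \<Gamma> u v"
  proof (cases "\<exists>e\<in>gedges \<Gamma>. point_support (vertex_point u) \<union> point_support (vertex_point v) \<subseteq> e")
    case True
    then obtain a b where e: "{a, b} \<in> gedges \<Gamma>" "point_support (vertex_point u) \<union> point_support (vertex_point v) \<subseteq> {a, b}"
      using edge_obtain[OF assms(1)] by metis
    have "{b, a} \<in> gedges \<Gamma>" using e(1) by (simp add: insert_commute)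
    then have "vdist \<Gamma> a b = 1" "vdist \<Gamma> b a = 1" "a \<noteq> b"
      using vdist_edge_eq[OF assms(1)] e(1) edge_in(3)[OF assms(1)] by auto
    then show ?thesis
      using rdist_common_edge(1)[OF assms(1) r e] e(2) vdist_refl[OF assms(2)]
      unfolding supp by (auto simp: vertex_point_def)
  next
    case False
    show ?thesis
      using rdist_far(2)[OF assms(1) r False] unfolding supp by (simp add: vertex_point_def)
  qed
qed

text \<open>Clearing the halves in the Gromov products doubles the constant. Hyperbolicity is stated
  without a sign condition on \<delta>, so the maximum with 0 is taken to make the later estimates
  monotone in it.\<close>

lemma hyperbolic_graph_four_point:
  assumes "connected_graph \<Gamma>" "hyperbolic_graph \<Gamma>"
  obtains \<delta> where "0 \<le> \<delta>"
    "\<And>a b c e. \<lbrakk>a \<in> gverts \<Gamma>; b \<in> gverts \<Gamma>; c \<in> gverts \<Gamma>; e \<in> gverts \<Gamma>\<rbrakk> \<Longrightarrow>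
      vdist \<Gamma> a c + vdist \<Gamma> b e \<le> max (vdist \<Gamma> a b + vdist \<Gamma> c e) (vdist \<Gamma> b c + vdist \<Gamma> a e) + \<delta>"
proof -
  note g = graph_if_connected[OF assms(1)]
  obtain \<delta> where \<delta>: "gromov_hyperbolic \<delta> (realization \<Gamma>) (rdist \<Gamma>)"
    using assms(2) unfolding hyperbolic_graph_def by blast
  note i = rdist_vertices[OF g]
  have "vdist \<Gamma> a c + vdist \<Gamma> b e \<le>
      max (vdist \<Gamma> a b + vdist \<Gamma> c e) (vdist \<Gamma> b c + vdist \<Gamma> a e) + 2 * max \<delta> 0"
    if *: "a \<in> gverts \<Gamma>" "b \<in> gverts \<Gamma>" "c \<in> gverts \<Gamma>" "e \<in> gverts \<Gamma>" for a b c e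
  proof -
    have "gromov_product (rdist \<Gamma>) (vertex_point e) (vertex_point a) (vertex_point c) \<ge>
      min (gromov_product (rdist \<Gamma>) (vertex_point e) (vertex_point a) (vertex_point b)) (gromov_product (rdist \<Gamma>) (vertex_point e) (vertex_point b) (vertex_point c)) - \<delta>"
      using \<delta> i(1) * unfolding gromov_hyperbolic_def by auto
    then show ?thesis
      using * by (simp add: gromov_product_def i min_def max_def divide_simps split: if_splits)
  qed
  then show thesis
    by (rule that[of "2 * max \<delta> 0", rotated]) simp_all
qed

lemma gdist_subgraph:
  assumes "is_subgraph \<Delta> \<Gamma>"
  shows "gdist \<Gamma> u v \<le> gdist \<Delta> u v"
proof (cases "gdist \<Delta> u v")
  case (enat n)
  have "gdist \<Gamma> (id u) (id v) \<le> enat (1 * n)"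
  proof (rule gdist_map[where f = id and \<Gamma> = \<Delta> and c = 1])
    show "\<And>x y. {x, y} \<in> gedges \<Delta> \<Longrightarrow> gdist \<Gamma> (id x) (id y) \<le> enat 1"
      using assms gdist_le_walk[of \<Gamma> _ "[x, y]" y for x y]
      unfolding is_subgraph_def is_graph_def by (fastforce simp: walk_Cons_Cons walk_singleton)
  qed (use assms enat in \<open>auto simp: is_subgraph_def\<close>)
  then show ?thesis using enat by simp
qed simp

section \<open>Coordinates and edges of the augmented space\<close>

primrec depth :: "'v aug_vertex \<Rightarrow> nat" where
  "depth (Base v) = 0"
| "depth (Deep \<Lambda> v n) = n"

primrec shadow :: "'v aug_vertex \<Rightarrow> 'v" where
  "shadow (Base v) = v"
| "shadow (Deep \<Lambda> v n) = v"

lemma attach_0 [simp]: "attach \<Lambda> (v, 0) = Base v"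
  by (simp add: attach_def)

lemma depth_attach [simp]: "depth (attach \<Lambda> (v, n)) = n"
  by (simp add: attach_def)

lemma shadow_attach [simp]: "shadow (attach \<Lambda> (v, n)) = v"
  by (simp add: attach_def)

lemma attach_eq_iff: "attach \<Lambda> x = attach \<Lambda> y \<longleftrightarrow> x = y"
  by (cases x; cases y) (auto simp: attach_def)

lemma verts_augmented_space:
  "x \<in> gverts (augmented_space \<Gamma>' \<L>) \<longleftrightarrow>
     (\<exists>v\<in>gverts \<Gamma>'. x = Base v) \<or> (\<exists>\<Lambda>\<in>\<L>. \<exists>v\<in>gverts \<Lambda>. \<exists>n. x = attach \<Lambda> (v, n))"
  by (auto simp: augmented_space_def horoball_def image_iff)

lemma edges_augmented_space_horizontal:
  assumes "\<Lambda> \<in> \<L>" "v \<in> gverts \<Lambda>" "w \<in> gverts \<Lambda>" "v \<noteq> w" "gdist \<Lambda> v w \<le> enat (2 ^ n)"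
  shows "{attach \<Lambda> (v, n), attach \<Lambda> (w, n)} \<in> gedges (augmented_space \<Gamma>' \<L>)"
proof -
  have "0 < gdist \<Lambda> v w"
    using assms(4) gdist_eq_0D[of \<Lambda> v w] by (auto simp: gr_zeroI)
  then have "{(v, n), (w, n)} \<in> gedges (horoball \<Lambda>)"
    using assms unfolding horoball_def by fastforce
  then have "attach \<Lambda> ` {(v, n), (w, n)} \<in> gedges (augmented_space \<Gamma>' \<L>)"
    using assms(1) unfolding augmented_space_def by (simp del: image_insert) blast
  then show ?thesis by simp
qed

lemma edges_augmented_space_vertical:
  assumes "\<Lambda> \<in> \<L>" "v \<in> gverts \<Lambda>"
  shows "{attach \<Lambda> (v, n), attach \<Lambda> (v, Suc n)} \<in> gedges (augmented_space \<Gamma>' \<L>)"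
proof -
  have "{(v, n), (v, Suc n)} \<in> gedges (horoball \<Lambda>)"
    using assms unfolding horoball_def by auto
  then have "attach \<Lambda> ` {(v, n), (v, Suc n)} \<in> gedges (augmented_space \<Gamma>' \<L>)"
    using assms(1) unfolding augmented_space_def by (simp del: image_insert) blast
  then show ?thesis by simp
qed

lemma edges_augmented_space_cases:
  assumes "e \<in> gedges (augmented_space \<Gamma>' \<L>)" "is_graph \<Gamma>'"
  obtains (base) u v where "e = {Base u, Base v}" "{u, v} \<in> gedges \<Gamma>'"
  | (vertical) \<Lambda> v n where "\<Lambda> \<in> \<L>" "v \<in> gverts \<Lambda>" "e = {attach \<Lambda> (v, n), attach \<Lambda> (v, Suc n)}"
  | (horizontal) \<Lambda> v w n where "\<Lambda> \<in> \<L>" "v \<in> gverts \<Lambda>" "w \<in> gverts \<Lambda>" "v \<noteq> w"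
      "gdist \<Lambda> v w \<le> enat (2 ^ n)" "e = {attach \<Lambda> (v, n), attach \<Lambda> (w, n)}"
proof -
  consider e' where "e' \<in> gedges \<Gamma>'" "e = Base ` e'"
    | \<Lambda> e' where "\<Lambda> \<in> \<L>" "e' \<in> gedges (horoball \<Lambda>)" "e = attach \<Lambda> ` e'"
    using assms(1) unfolding augmented_space_def by auto
  then show thesis
  proof cases
    case 1
    with edge_obtain[OF assms(2) 1(1)] base show thesis by (metis image_empty image_insert)
  next
    case 2
    consider v n where "e' = {(v, n), (v, Suc n)}" "v \<in> gverts \<Lambda>"
      | v w n where "e' = {(v, n), (w, n)}" "v \<in> gverts \<Lambda>" "w \<in> gverts \<Lambda>" "0 < gdist \<Lambda> v w"
          "gdist \<Lambda> v w \<le> enat (2 ^ n)"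
      using 2(2) unfolding horoball_def by auto
    then show thesis
    proof cases
      case 1
      then show ?thesis using vertical 2 by simp
    next
      case inner: 2
      then have "v \<noteq> w" using gdist_refl[of v \<Lambda>] by auto
      then show ?thesis using horizontal 2 inner by simp
    qed
  qed
qed

text \<open>A symmetric relation between the ends of an edge is verified on one orientation of each
  kind of edge.\<close>

lemma edges_augmented_space_induct:
  assumes "{x, y} \<in> gedges (augmented_space \<Gamma>' \<L>)" "is_graph \<Gamma>'"
    and sym: "\<And>x y. P x y \<Longrightarrow> P y x"
    and "\<And>u v. {u, v} \<in> gedges \<Gamma>' \<Longrightarrow> P (Base u) (Base v)"
    and "\<And>\<Lambda> v n. \<lbrakk>\<Lambda> \<in> \<L>; v \<in> gverts \<Lambda>\<rbrakk> \<Longrightarrow> P (attach \<Lambda> (v, n)) (attach \<Lambda> (v, Suc n))"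
    and "\<And>\<Lambda> v w n. \<lbrakk>\<Lambda> \<in> \<L>; v \<in> gverts \<Lambda>; w \<in> gverts \<Lambda>; gdist \<Lambda> v w \<le> enat (2 ^ n)\<rbrakk>
      \<Longrightarrow> P (attach \<Lambda> (v, n)) (attach \<Lambda> (w, n))"
  shows "P x y"
proof -
  have *: "P x y" if "{x, y} = {a, b}" "P a b" for a b
    using that sym by (auto simp: doubleton_eq_iff)
  show ?thesis
    by (rule edges_augmented_space_cases[OF assms(1,2)]) (rule *, assumption, rule assms(4-6); assumption)+
qed

text \<open>All that the convexity argument needs from hyperbolicity. Both bounds are in the metric
  of \<Gamma>', without horoballs. The last one is independent of the distance between
  \<open>x\<close> and \<open>y\<close>, so that Rips edges of any length in another coset are
  contracted as well.\<close>

definition contracting_retraction ::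
  "'v ugraph \<Rightarrow> 'v ugraph set \<Rightarrow> nat \<Rightarrow> 'v ugraph \<Rightarrow> ('v \<Rightarrow> 'v) \<Rightarrow> bool" where
  "contracting_retraction \<Gamma>' \<L> B \<Lambda> \<pi> \<longleftrightarrow>
     (\<forall>x. \<pi> x \<in> gverts \<Lambda>) \<and> (\<forall>x\<in>gverts \<Lambda>. \<pi> x = x) \<and>
     (\<forall>x y. {x, y} \<in> gedges \<Gamma>' \<longrightarrow> gdist \<Gamma>' (\<pi> x) (\<pi> y) \<le> enat B) \<and>
     (\<forall>\<Lambda>'\<in>\<L> - {\<Lambda>}. \<forall>x\<in>gverts \<Lambda>'. \<forall>y\<in>gverts \<Lambda>'. gdist \<Gamma>' (\<pi> x) (\<pi> y) \<le> enat B)"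

section \<open>Metric properties of the augmented space over a family of connected subgraphs\<close>

locale subgraph_family =
  fixes \<Gamma>' :: "'v ugraph" and \<L> :: "'v ugraph set"
  assumes conn: "connected_graph \<Gamma>'"
    and sub: "\<And>\<Lambda>. \<Lambda> \<in> \<L> \<Longrightarrow> connected_graph \<Lambda> \<and> is_subgraph \<Lambda> \<Gamma>'"
begin

abbreviation X :: "'v aug_vertex ugraph" where
  "X \<equiv> augmented_space \<Gamma>' \<L>"

lemma attach_in: "\<Lambda> \<in> \<L> \<Longrightarrow> v \<in> gverts \<Lambda> \<Longrightarrow> attach \<Lambda> (v, n) \<in> gverts X"
  by (auto simp: verts_augmented_space)

lemma Base_in: "v \<in> gverts \<Gamma>' \<Longrightarrow> Base v \<in> gverts X"
  by (auto simp: verts_augmented_space)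

lemma sub_verts: "\<Lambda> \<in> \<L> \<Longrightarrow> v \<in> gverts \<Lambda> \<Longrightarrow> v \<in> gverts \<Gamma>'"
  using sub unfolding is_subgraph_def by blast

lemma is_graph_augmented_space: "is_graph X"
  unfolding is_graph_def
proof (intro ballI)
  fix e assume "e \<in> gedges X"
  then show "e \<subseteq> gverts X \<and> card e = 2"
    using graph_if_connected[OF conn]
  proof (cases rule: edges_augmented_space_cases)
    case (base u v)
    then show ?thesis
      using edge_in[OF graph_if_connected[OF conn] base(2)] by (simp add: Base_in)
  qed (auto simp: attach_in attach_eq_iff)
qed

lemma gdist_attach:
  assumes "\<Lambda> \<in> \<L>" "v \<in> gverts \<Lambda>"
  shows "gdist X (Base v) (attach \<Lambda> (v, n)) \<le> enat n"
proof (induction n)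
  case 0
  then show ?case using gdist_refl[OF Base_in[OF sub_verts[OF assms]]] by simp
next
  case (Suc n)
  have "gdist X (attach \<Lambda> (v, n)) (attach \<Lambda> (v, Suc n)) \<le> enat 1"
    using gdist_edge[OF is_graph_augmented_space edges_augmented_space_vertical[OF assms]]
    by (simp add: one_enat_def)
  from gdist_triangle_le[OF Suc this] show ?case by simp
qed

lemma connected_augmented_space: "connected_graph X"
proof -
  note g = graph_if_connected[OF conn]
  obtain r where r: "r \<in> gverts \<Gamma>'" using conn unfolding connected_graph_def by auto
  have b: "gdist X (Base r) (Base v) \<noteq> \<infinity>" if v: "v \<in> gverts \<Gamma>'" for v
  proof -
    obtain n where "gdist \<Gamma>' r v \<le> enat n"
      using gdist_finite[OF conn r v] by (metis enat.exhaust order_refl)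
    then have "gdist X (Base r) (Base v) \<le> enat (1 * n)"
    proof (rule gdist_map[rotated 2])
      fix x y assume "{x, y} \<in> gedges \<Gamma>'"
      then have "{Base x, Base y} \<in> gedges X"
        unfolding augmented_space_def by (simp add: rev_image_eqI)
      then show "gdist X (Base x) (Base y) \<le> enat 1"
        using gdist_edge[OF is_graph_augmented_space] by (simp add: one_enat_def)
    qed (rule Base_in)
    then show ?thesis by (rule gdist_le_imp_finite)
  qed
  show ?thesis
  proof (rule connected_graph_gdist[OF is_graph_augmented_space Base_in[OF r]])
    fix x assume "x \<in> gverts X"
    then consider v where "v \<in> gverts \<Gamma>'" "x = Base v"
      | \<Lambda> v n where "\<Lambda> \<in> \<L>" "v \<in> gverts \<Lambda>" "x = attach \<Lambda> (v, n)"
      unfolding verts_augmented_space by blast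
    then show "gdist X (Base r) x \<noteq> \<infinity>"
    proof cases
      case 2
      have "gdist X (Base v) x \<noteq> \<infinity>" "gdist X (Base r) (Base v) \<noteq> \<infinity>"
        using gdist_le_imp_finite[OF gdist_attach[OF 2(1,2)]] 2(3) b[OF sub_verts[OF 2(1,2)]] by blast+
      then show ?thesis
        by (metis gdist_le_imp_finite gdist_triangle_le not_infinity_eq order_refl)
    qed (use b in simp)
  qed
qed

text \<open>Horoballs shorten distances at most exponentially: a walk of length \<open>n\<close>
  that starts at depth 0 stays at depth at most \<open>n\<close>, where an edge casts a shadow of
  length at most \<open>2 ^ n\<close>. Bounds in the augmented space thus return to
  \<Gamma>'.\<close>

lemma gdist_shadow:
  assumes "gdist X (Base u) (Base v) \<le> enat n"
  shows "gdist \<Gamma>' u v \<le> enat (n * 2 ^ n)"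
proof -
  have *: "gdist \<Gamma>' (shadow x) (shadow y) \<le> enat (2 ^ depth x) \<and>
      gdist \<Gamma>' (shadow y) (shadow x) \<le> enat (2 ^ depth y) \<and>
      depth x \<le> Suc (depth y) \<and> depth y \<le> Suc (depth x)" if "{x, y} \<in> gedges X" for x y
    using that graph_if_connected[OF conn]
  proof (rule edges_augmented_space_induct)
    fix u v assume "{u, v} \<in> gedges \<Gamma>'"
    from gdist_edge[OF graph_if_connected[OF conn] this]
    show "gdist \<Gamma>' (shadow (Base u)) (shadow (Base v)) \<le> enat (2 ^ depth (Base u)) \<and>
      gdist \<Gamma>' (shadow (Base v)) (shadow (Base u)) \<le> enat (2 ^ depth (Base v)) \<and>
      depth (Base u) \<le> Suc (depth (Base v)) \<and> depth (Base v) \<le> Suc (depth (Base u))"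
      by (simp add: gdist_commute[of _ v u] one_enat_def)
  next
    fix \<Lambda> :: "'v ugraph" and v w n
    assume "\<Lambda> \<in> \<L>" "gdist \<Lambda> v w \<le> enat (2 ^ n)"
    then show "gdist \<Gamma>' (shadow (attach \<Lambda> (v, n))) (shadow (attach \<Lambda> (w, n))) \<le>
        enat (2 ^ depth (attach \<Lambda> (v, n))) \<and>
      gdist \<Gamma>' (shadow (attach \<Lambda> (w, n))) (shadow (attach \<Lambda> (v, n))) \<le>
        enat (2 ^ depth (attach \<Lambda> (w, n))) \<and>
      depth (attach \<Lambda> (v, n)) \<le> Suc (depth (attach \<Lambda> (w, n))) \<and>
      depth (attach \<Lambda> (w, n)) \<le> Suc (depth (attach \<Lambda> (v, n)))"
      using gdist_subgraph[of \<Lambda> \<Gamma>' v w] sub by (auto simp: gdist_commute[of _ w v] intro: order_trans)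
  qed (auto simp: gdist_refl sub_verts)
  \<comment> \<open>The invariant bounds current depth plus remaining length by a fixed
    \<open>N\<close>; a step deeper is paid for by the step it uses.\<close>
  have walk: "gdist \<Gamma>' (shadow x) (shadow y) \<le> enat ((length p - 1) * 2 ^ N)"
    if "walk X x p y" "depth x + (length p - 1) \<le> N" for x y p N
    using that
  proof (induction p arbitrary: x rule: induct_list012)
    case (2 a)
    then have "shadow y \<in> gverts \<Gamma>'"
      by (auto simp: walk_singleton verts_augmented_space sub_verts)
    then show ?case using 2 by (auto simp: walk_singleton gdist_refl)
  next
    case (3 a b zs)
    then have e: "a = x" "{x, b} \<in> gedges X" "walk X b (b # zs) y" by (auto simp: walk_Cons_Cons)
    have "gdist \<Gamma>' (shadow b) (shadow y) \<le> enat (length zs * 2 ^ N)"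
      using "3.IH"(2)[OF e(3)] *[OF e(2)] 3(4) by simp
    moreover have "gdist \<Gamma>' (shadow x) (shadow b) \<le> enat (2 ^ N)"
    proof -
      have "(2::nat) ^ depth x \<le> 2 ^ N" using 3(4) by (intro power_increasing) auto
      then show ?thesis using *[OF e(2)] by (meson enat_ord_simps(1) order_trans)
    qed
    ultimately show ?case using gdist_triangle_le by fastforce
  qed (simp add: walk_def)
  obtain p where p: "walk X (Base u) p (Base v)" "gdist X (Base u) (Base v) = enat (length p - 1)"
    by (rule shortest_walk[OF gdist_le_imp_finite[OF assms]])
  have "gdist \<Gamma>' u v \<le> enat ((length p - 1) * 2 ^ n)"
    using walk[OF p(1), of n] p(2) assms by simp
  also have "\<dots> \<le> enat (n * 2 ^ n)"
    using p(2) assms by simp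
  finally show ?thesis .
qed

subsection \<open>Projection to a horoball\<close>

abbreviation d :: "'v aug_vertex \<Rightarrow> 'v aug_vertex \<Rightarrow> real" where
  "d \<equiv> vdist X"

text \<open>Nearest points need not be unique; the estimates hold for whichever one is chosen.
  Nearness is measured in the augmented space, where the four-point inequality lives.\<close>

definition nearest :: "'v ugraph \<Rightarrow> 'v aug_vertex \<Rightarrow> 'v" where
  "nearest \<Lambda> x = (ARG_MIN (\<lambda>v. gdist X x (Base v)) v. v \<in> gverts \<Lambda>)"

abbreviation height :: "'v ugraph \<Rightarrow> 'v aug_vertex \<Rightarrow> real" where
  "height \<Lambda> x \<equiv> d x (Base (nearest \<Lambda> x))"

text \<open>Only the vertices of positive depth are removed: those of \<Lambda> itself count as
  outside, at height 0.\<close>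

definition outside :: "'v ugraph \<Rightarrow> 'v aug_vertex \<Rightarrow> bool" where
  "outside \<Lambda> x \<longleftrightarrow> x \<in> gverts X \<and> (\<forall>v n. x \<noteq> Deep \<Lambda> v n)"

lemma nearest:
  assumes "\<Lambda> \<in> \<L>"
  shows "nearest \<Lambda> x \<in> gverts \<Lambda>"
    and "\<lbrakk>x \<in> gverts X; h \<in> gverts \<Lambda>\<rbrakk> \<Longrightarrow> height \<Lambda> x \<le> d x (Base h)"
proof -
  obtain v where v: "v \<in> gverts \<Lambda>"
    using sub[OF assms] unfolding connected_graph_def by auto
  have "\<exists>m. m \<in> gverts \<Lambda> \<and> (\<forall>y. y \<in> gverts \<Lambda> \<longrightarrow> gdist X x (Base m) \<le> gdist X x (Base y))"
  proof -
    let ?A = "(\<lambda>v. gdist X x (Base v)) ` gverts \<Lambda>"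
    have "Inf ?A \<in> ?A"
      using v unfolding Inf_enat_def by (auto intro: LeastI)
    then obtain m where "m \<in> gverts \<Lambda>" "Inf ?A = gdist X x (Base m)" by blast
    moreover have "Inf ?A \<le> gdist X x (Base y)" if "y \<in> gverts \<Lambda>" for y
      using that by (intro Inf_lower) blast
    ultimately show ?thesis by metis
  qed
  then have *: "is_arg_min (\<lambda>v. gdist X x (Base v)) (\<lambda>v. v \<in> gverts \<Lambda>) (nearest \<Lambda> x)"
    unfolding nearest_def arg_min_def is_arg_min_linorder by (rule someI_ex)
  then show n: "nearest \<Lambda> x \<in> gverts \<Lambda>"
    by (simp add: is_arg_min_def)
  assume xh: "x \<in> gverts X" "h \<in> gverts \<Lambda>"
  have "gdist X x (Base (nearest \<Lambda> x)) \<le> gdist X x (Base h)"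
    using * xh by (simp add: is_arg_min_linorder)
  moreover have "gdist X x (Base h) \<noteq> \<infinity>"
    using gdist_finite[OF connected_augmented_space xh(1) Base_in[OF sub_verts[OF assms xh(2)]]] .
  ultimately show "height \<Lambda> x \<le> d x (Base h)"
    unfolding vdist_def by (cases "gdist X x (Base h)"; cases "gdist X x (Base (nearest \<Lambda> x))") auto
qed

lemma nearest_self:
  assumes "\<Lambda> \<in> \<L>" "v \<in> gverts \<Lambda>"
  shows "nearest \<Lambda> (Base v) = v" "height \<Lambda> (Base v) = 0"
proof -
  have v: "Base v \<in> gverts X" using assms Base_in sub_verts by blast
  show h: "height \<Lambda> (Base v) = 0"
    using nearest(2)[OF assms(1) v assms(2)] vdist_refl[OF v] vdist_nonneg[of X "Base v" "Base (nearest \<Lambda> (Base v))"]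
    by simp
  have "gdist X (Base v) (Base (nearest \<Lambda> (Base v))) \<noteq> \<infinity>"
    using gdist_finite[OF connected_augmented_space v Base_in[OF sub_verts[OF assms(1) nearest(1)[OF assms(1)]]]] .
  then have "gdist X (Base v) (Base (nearest \<Lambda> (Base v))) = 0"
    using h by (auto simp: vdist_def zero_enat_def)
  then show "nearest \<Lambda> (Base v) = v"
    by (metis gdist_eq_0D aug_vertex.inject(1))
qed

lemma height_lipschitz:
  assumes "\<Lambda> \<in> \<L>" "x \<in> gverts X" "y \<in> gverts X"
  shows "height \<Lambda> x \<le> height \<Lambda> y + d x y"
proof -
  have n: "Base (nearest \<Lambda> y) \<in> gverts X"
    using Base_in[OF sub_verts[OF assms(1) nearest(1)[OF assms(1)]]] .
  have "height \<Lambda> x \<le> d x (Base (nearest \<Lambda> y))"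
    by (rule nearest(2)[OF assms(1,2) nearest(1)[OF assms(1)]])
  also have "\<dots> \<le> d x y + height \<Lambda> y"
    by (rule vdist_triangle[OF connected_augmented_space assms(2,3) n])
  finally show ?thesis by simp
qed

text \<open>The function that is \<open>height\<close> outside the horoball and minus the depth inside is
  1-Lipschitz: a Busemann function of the horoball up to a bounded error.\<close>

lemma dist_deep_ge:
  assumes L: "\<Lambda> \<in> \<L>" and x: "outside \<Lambda> x" and h: "h \<in> gverts \<Lambda>"
  shows "height \<Lambda> x + n \<le> d x (attach \<Lambda> (h, n))"
proof -
  define f where "f y = (case y of Base v \<Rightarrow> height \<Lambda> y
    | Deep \<Lambda>' v m \<Rightarrow> if \<Lambda>' = \<Lambda> then - real m else height \<Lambda> y)" for y
  \<comment> \<open>At depth 0 the vertex is \<open>Base v\<close>, whose height 0 agrees with minus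
    its depth: the two branches of \<open>f\<close> fit together along \<Lambda>.\<close>
  have fL: "f (attach \<Lambda> (v, m)) = - real m" if "v \<in> gverts \<Lambda>" for v m
    using nearest_self[OF L that] by (simp add: f_def attach_def)
  have fo: "f y = height \<Lambda> y" if "outside \<Lambda> y" for y
    using that unfolding f_def outside_def by (auto split: aug_vertex.split)
  have out: "outside \<Lambda> (attach \<Lambda>' (v, m))" if "\<Lambda>' \<in> \<L>" "v \<in> gverts \<Lambda>'" "\<Lambda>' \<noteq> \<Lambda>" for \<Lambda>' v m
    using that attach_in[OF that(1,2)] unfolding outside_def by (auto simp: attach_def)
  have o: "\<bar>f x - f y\<bar> \<le> 1" if e: "{x, y} \<in> gedges X" and "outside \<Lambda> x" "outside \<Lambda> y" for x y
  proof -
    have "d x y = 1" using vdist_edge_eq[OF is_graph_augmented_space e] .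
    moreover have "height \<Lambda> x \<le> height \<Lambda> y + d x y" "height \<Lambda> y \<le> height \<Lambda> x + d y x"
      using that height_lipschitz[OF L] unfolding outside_def by auto
    ultimately show ?thesis
      using that by (simp add: fo vdist_commute[of X y x])
  qed
  \<comment> \<open>The edge is repeated inside the relation so that each case of the induction can
    still use it for \<open>o\<close>; within the horoball over \<Lambda> the depths alone
    decide.\<close>
  have lip: "{x, y} \<in> gedges X \<longrightarrow> \<bar>f x - f y\<bar> \<le> 1" if "{x, y} \<in> gedges X" for x y
    using that graph_if_connected[OF conn]
  proof (rule edges_augmented_space_induct)
    show "{Base u, Base v} \<in> gedges X \<longrightarrow> \<bar>f (Base u) - f (Base v)\<bar> \<le> 1" if "{u, v} \<in> gedges \<Gamma>'" for u v
      using o[of "Base u" "Base v"] edge_in(1,2)[OF graph_if_connected[OF conn] that] Base_in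
      unfolding outside_def by auto
    show "{attach \<Lambda>' (v, n), attach \<Lambda>' (v, Suc n)} \<in> gedges X \<longrightarrow>
        \<bar>f (attach \<Lambda>' (v, n)) - f (attach \<Lambda>' (v, Suc n))\<bar> \<le> 1"
      if "\<Lambda>' \<in> \<L>" "v \<in> gverts \<Lambda>'" for \<Lambda>' v n
      using o out[OF that] fL[of v] that by (cases "\<Lambda>' = \<Lambda>") auto
    show "{attach \<Lambda>' (v, n), attach \<Lambda>' (w, n)} \<in> gedges X \<longrightarrow>
        \<bar>f (attach \<Lambda>' (v, n)) - f (attach \<Lambda>' (w, n))\<bar> \<le> 1"
      if "\<Lambda>' \<in> \<L>" "v \<in> gverts \<Lambda>'" "w \<in> gverts \<Lambda>'" for \<Lambda>' v w n
      using o out[OF that(1)] fL that by (cases "\<Lambda>' = \<Lambda>") auto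
  qed (simp add: insert_commute abs_minus_commute)
  have "f x - f (attach \<Lambda> (h, n)) \<le> d x (attach \<Lambda> (h, n))"
  proof (rule vdist_lipschitz[OF connected_augmented_space])
    show "f x - f y \<le> 1" if "{x, y} \<in> gedges X" for x y
      using lip[OF that] that by simp
  qed (use x attach_in[OF L h] in \<open>auto simp: outside_def\<close>)
  then show ?thesis
    by (simp add: fL[OF h] fo[OF x])
qed

text \<open>Descend \<open>n\<close> vertical edges from \<open>v\<close>; at that depth
  \<open>v\<close> and \<open>h\<close> are adjacent or equal, which accounts for the extra
  1.\<close>

lemma dist_deep_le:
  assumes "\<Lambda> \<in> \<L>" "v \<in> gverts \<Lambda>" "h \<in> gverts \<Lambda>" "gdist \<Lambda> v h \<le> enat (2 ^ n)"
  shows "d (Base v) (attach \<Lambda> (h, n)) \<le> n + 1"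
proof -
  have "gdist X (attach \<Lambda> (v, n)) (attach \<Lambda> (h, n)) \<le> enat 1"
  proof (cases "v = h")
    case False
    show ?thesis
      using gdist_edge[OF is_graph_augmented_space edges_augmented_space_horizontal[OF assms(1-3) False assms(4)]]
      by (simp add: one_enat_def)
  qed (simp add: gdist_refl[OF attach_in[OF assms(1,3)]])
  then have "gdist X (Base v) (attach \<Lambda> (h, n)) \<le> enat (n + 1)"
    by (rule gdist_triangle_le[OF gdist_attach[OF assms(1,2)]])
  then show ?thesis
    using gdist_le_iff_vdist[OF connected_augmented_space Base_in[OF sub_verts[OF assms(1,2)]] attach_in[OF assms(1,3)]]
    by fastforce
qed

text \<open>Depth changes by at most 1 along an edge, and the vertices of \<Lambda> have depth
  0.\<close>

lemma height_attach_ge: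
  assumes "\<Lambda> \<in> \<L>" "\<Lambda>' \<in> \<L>" "v \<in> gverts \<Lambda>'"
  shows "n \<le> height \<Lambda> (attach \<Lambda>' (v, n))"
proof -
  have "real (depth (attach \<Lambda>' (v, n))) - real (depth (Base (nearest \<Lambda> (attach \<Lambda>' (v, n)))))
      \<le> height \<Lambda> (attach \<Lambda>' (v, n))"
  proof (rule vdist_lipschitz[OF connected_augmented_space])
    fix x y assume "{x, y} \<in> gedges X"
    then have "\<bar>real (depth x) - real (depth y)\<bar> \<le> 1"
      by (rule edges_augmented_space_induct[OF _ graph_if_connected[OF conn]]) auto
    then show "real (depth x) - real (depth y) \<le> 1" by simp
  qed (use attach_in[OF assms(2,3)] Base_in[OF sub_verts[OF assms(1) nearest(1)[OF assms(1)]]] in auto)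
  then show ?thesis by simp
qed

context
  fixes \<delta> :: real
  assumes \<delta>: "0 \<le> \<delta>"
    and four_point: "\<And>a b c e. \<lbrakk>a \<in> gverts X; b \<in> gverts X; c \<in> gverts X; e \<in> gverts X\<rbrakk> \<Longrightarrow>
      d a c + d b e \<le> max (d a b + d c e) (d b c + d a e) + \<delta>"
begin

text \<open>Passing through the projection \<open>p\<close> is nearly optimal on the way from
  \<open>x\<close> to \<open>q\<close>. The four-point inequality is applied to \<open>x\<close>,
  \<open>p\<close>, \<open>q\<close> and a vertex \<open>?w\<close> of depth \<open>m\<close> over
  \<open>p\<close>: both \<open>p\<close> and \<open>q\<close> are within \<open>m + 1\<close> of
  \<open>?w\<close>, while \<open>x\<close> is at least \<open>height + m\<close> away, so
  \<open>m\<close> cancels and one unit remains besides \<delta>.\<close>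

lemma dist_base_ge:
  assumes L: "\<Lambda> \<in> \<L>" and x: "outside \<Lambda> x" and q: "q \<in> gverts \<Lambda>"
  shows "height \<Lambda> x + d (Base (nearest \<Lambda> x)) (Base q) \<le> d x (Base q) + \<delta> + 1"
proof -
  define p where "p = nearest \<Lambda> x"
  have p: "p \<in> gverts \<Lambda>" unfolding p_def by (rule nearest(1)[OF L])
  obtain m where "gdist \<Lambda> q p = enat m"
    using gdist_finite[of \<Lambda> q p] sub[OF L] p q by (metis not_infinity_eq)
  \<comment> \<open>Any depth with \<open>2 ^ m\<close> at least the distance from \<open>q\<close>
    to \<open>p\<close> would serve; the distance itself is such a depth.\<close>
  moreover have "m \<le> 2 ^ m" by (simp add: less_imp_le)
  ultimately have m: "gdist \<Lambda> q p \<le> enat (2 ^ m)" "gdist \<Lambda> p p \<le> enat (2 ^ m)"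
    using gdist_refl[OF p] by simp_all
  let ?w = "attach \<Lambda> (p, m)"
  have V: "x \<in> gverts X" "Base p \<in> gverts X" "Base q \<in> gverts X" "?w \<in> gverts X"
    using x Base_in[OF sub_verts[OF L]] attach_in[OF L p] p q unfolding outside_def by auto
  have "d x ?w + d (Base p) (Base q) \<le> max (d x (Base p) + d ?w (Base q)) (d (Base p) ?w + d x (Base q)) + \<delta>"
    by (rule four_point) (use V in auto)
  moreover have "height \<Lambda> x + m \<le> d x ?w" by (rule dist_deep_ge[OF L x p])
  moreover have "d (Base p) ?w \<le> m + 1" "d (Base q) ?w \<le> m + 1"
    using dist_deep_le[OF L] p q m by auto
  moreover have "height \<Lambda> x \<le> d x (Base q)" by (rule nearest(2)[OF L V(1) q])
  ultimately show ?thesis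
    using vdist_commute[of X ?w "Base q"] unfolding p_def by linarith
qed

text \<open>Projections can be far apart only if \<open>d x y\<close> exceeds the sum of the
  heights. In the four-point inequality for \<open>x\<close>, \<open>y\<close> and their
  projections, the left side contains the distance of the projections twice, the right side at most
  once. The constant collects one \<delta> from that inequality and \<open>\<delta> + 1\<close> from
  each of two uses of \<open>dist_base_ge\<close>.\<close>

lemma dist_nearest_le:
  assumes L: "\<Lambda> \<in> \<L>" and x: "outside \<Lambda> x" and y: "outside \<Lambda> y"
  shows "d (Base (nearest \<Lambda> x)) (Base (nearest \<Lambda> y)) \<le>
    max 0 (d x y - height \<Lambda> x - height \<Lambda> y) + 3 * \<delta> + 2"
proof -
  let ?p = "Base (nearest \<Lambda> x)" and ?r = "Base (nearest \<Lambda> y)"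
  have V: "x \<in> gverts X" "y \<in> gverts X" "?p \<in> gverts X" "?r \<in> gverts X"
    using x y Base_in[OF sub_verts[OF L nearest(1)[OF L]]] unfolding outside_def by auto
  have "d x ?r + d y ?p \<le> max (d x y + d ?r ?p) (d y ?r + d x ?p) + \<delta>"
    by (rule four_point) (use V in auto)
  moreover have "height \<Lambda> x + d ?p ?r \<le> d x ?r + \<delta> + 1" "height \<Lambda> y + d ?r ?p \<le> d y ?p + \<delta> + 1"
    by (rule dist_base_ge[OF L _ nearest(1)[OF L]]; fact)+
  ultimately show ?thesis
    using \<delta> vdist_nonneg[of X ?p ?r] vdist_commute[of X ?r ?p] by linarith
qed

lemma dist_nearest_edge:
  assumes L: "\<Lambda> \<in> \<L>" and e: "{x, y} \<in> gedges \<Gamma>'"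
  shows "d (Base (nearest \<Lambda> (Base x))) (Base (nearest \<Lambda> (Base y))) \<le> 3 * \<delta> + 3"
proof -
  have xy: "outside \<Lambda> (Base x)" "outside \<Lambda> (Base y)"
    using edge_in(1,2)[OF graph_if_connected[OF conn] e] Base_in unfolding outside_def by auto
  have "{Base x, Base y} \<in> gedges X"
    using e unfolding augmented_space_def by (simp add: rev_image_eqI)
  then have "d (Base x) (Base y) = 1"
    by (rule vdist_edge_eq[OF is_graph_augmented_space])
  then show ?thesis
    using dist_nearest_le[OF L xy] \<delta> vdist_nonneg[of X "Base x" "Base (nearest \<Lambda> (Base x))"]
      vdist_nonneg[of X "Base y" "Base (nearest \<Lambda> (Base y))"] by linarith
qed

text \<open>All vertices of \<open>\<Lambda>'\<close> are, up to 1, at the same distance \<open>m\<close> from a vertex \<open>w\<close> of depth \<open>m\<close>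
  over \<open>\<Lambda>'\<close>, and \<open>w\<close> is at distance at least \<open>m\<close> from \<open>\<Lambda>\<close>. Hence they all project near the
  projection of \<open>w\<close>.\<close>

lemma dist_nearest_horoball:
  assumes L: "\<Lambda> \<in> \<L>" "\<Lambda>' \<in> \<L>" "\<Lambda>' \<noteq> \<Lambda>" and x: "x \<in> gverts \<Lambda>'" and y: "y \<in> gverts \<Lambda>'"
  shows "d (Base (nearest \<Lambda> (Base x))) (Base (nearest \<Lambda> (Base y))) \<le> 6 * \<delta> + 6"
proof -
  obtain m where "gdist \<Lambda>' y x = enat m"
    using gdist_finite[of \<Lambda>' y x] sub[OF L(2)] x y by (metis not_infinity_eq)
  moreover have "m \<le> 2 ^ m" by (simp add: less_imp_le)
  ultimately have m: "gdist \<Lambda>' y x \<le> enat (2 ^ m)" "gdist \<Lambda>' x x \<le> enat (2 ^ m)"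
    using gdist_refl[OF x] by simp_all
  let ?w = "attach \<Lambda>' (x, m)"
  have w: "outside \<Lambda> ?w"
    using attach_in[OF L(2) x] L(3) unfolding outside_def by (auto simp: attach_def)
  \<comment> \<open>Here \<open>d (Base z) ?w \<le> m + 1\<close> and \<open>?w\<close> has height
    at least \<open>m\<close>, so the maximum in \<open>dist_nearest_le\<close> is at most 1. Two
    such bounds give the final constant.\<close>
  have *: "d (Base (nearest \<Lambda> (Base z))) (Base (nearest \<Lambda> ?w)) \<le> 3 * \<delta> + 3"
    if z: "z \<in> gverts \<Lambda>'" "gdist \<Lambda>' z x \<le> enat (2 ^ m)" for z
  proof -
    have "outside \<Lambda> (Base z)"
      using Base_in[OF sub_verts[OF L(2) z(1)]] unfolding outside_def by auto
    from dist_nearest_le[OF L(1) this w] show ?thesis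
      using dist_deep_le[OF L(2) z(1) x z(2)] height_attach_ge[OF L(1,2) x, of m]
        vdist_nonneg[of X "Base z" "Base (nearest \<Lambda> (Base z))"] \<delta>
      by linarith
  qed
  note V = Base_in[OF sub_verts[OF L(1) nearest(1)[OF L(1)]]]
  show ?thesis
    using vdist_triangle[OF connected_augmented_space V V V, of "Base x" "Base y" ?w] *[OF x m(2)] *[OF y m(1)]
    by (simp add: vdist_commute[of X "Base (nearest \<Lambda> ?w)"])
qed

end

text \<open>One constant serves every member of the family, since the projection bounds depend on
  \<delta> only; \<open>gdist_shadow\<close> then translates them into the metric of \<Gamma>',
  whence \<open>C * 2 ^ C\<close>.\<close>

lemma contracting_retraction_exists:
  assumes "rel_hyperbolic_graph \<Gamma>' \<L>"
  shows "\<exists>B. \<forall>\<Lambda>\<in>\<L>. \<exists>\<pi>. contracting_retraction \<Gamma>' \<L> B \<Lambda> \<pi>"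
proof -
  obtain \<delta> where \<delta>: "0 \<le> \<delta>"
    "\<And>a b c e. \<lbrakk>a \<in> gverts X; b \<in> gverts X; c \<in> gverts X; e \<in> gverts X\<rbrakk> \<Longrightarrow>
      d a c + d b e \<le> max (d a b + d c e) (d b c + d a e) + \<delta>"
    using hyperbolic_graph_four_point[OF connected_augmented_space] assms unfolding rel_hyperbolic_graph_def by blast
  define C where "C = nat \<lceil>6 * \<delta> + 6\<rceil>"
  have C: "6 * \<delta> + 6 \<le> real C" unfolding C_def by linarith
  have sh: "gdist \<Gamma>' u v \<le> enat (C * 2 ^ C)"
    if "u \<in> gverts \<Gamma>'" "v \<in> gverts \<Gamma>'" "d (Base u) (Base v) \<le> 6 * \<delta> + 6" for u v
    by (rule gdist_shadow)
      (use that C Base_in gdist_le_iff_vdist[OF connected_augmented_space] in \<open>force+\<close>)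
  have "contracting_retraction \<Gamma>' \<L> (C * 2 ^ C) \<Lambda> (\<lambda>x. nearest \<Lambda> (Base x))"
    if L: "\<Lambda> \<in> \<L>" for \<Lambda>
    unfolding contracting_retraction_def
  proof (intro conjI allI ballI impI)
    note V = sub_verts[OF L nearest(1)[OF L]]
    show "gdist \<Gamma>' (nearest \<Lambda> (Base x)) (nearest \<Lambda> (Base y)) \<le> enat (C * 2 ^ C)"
      if "{x, y} \<in> gedges \<Gamma>'" for x y
      by (rule sh[OF V V]) (use dist_nearest_edge[OF \<delta> L that] \<delta>(1) in linarith)
    show "gdist \<Gamma>' (nearest \<Lambda> (Base x)) (nearest \<Lambda> (Base y)) \<le> enat (C * 2 ^ C)"
      if "\<Lambda>' \<in> \<L> - {\<Lambda>}" "x \<in> gverts \<Lambda>'" "y \<in> gverts \<Lambda>'" for \<Lambda>' x y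
      by (rule sh[OF V V dist_nearest_horoball[OF \<delta> L]]) (use that in auto)
  qed (rule nearest(1)[OF L], rule nearest_self(1)[OF L])
  then show ?thesis by blast
qed

end

section \<open>Rips graphs and retractions\<close>

lemma gdist_split:
  assumes "gdist \<Gamma> u v \<le> enat (a + b)"
  shows "\<exists>w\<in>gverts \<Gamma>. gdist \<Gamma> u w \<le> enat a \<and> gdist \<Gamma> w v \<le> enat b"
proof -
  obtain p where p: "walk \<Gamma> u p v" "gdist \<Gamma> u v = enat (length p - 1)"
    by (rule shortest_walk[OF gdist_le_imp_finite[OF assms]])
  show ?thesis
  proof (cases "length p \<le> Suc a")
    case True
    have "v \<in> gverts \<Gamma>" using walk_hd_in[OF walk_rev[OF p(1)]] .
    then show ?thesis
      using True p(2) by (intro bexI[of _ v]) (auto simp: gdist_refl)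
  next
    case False
    have split: "p = take (Suc a) p @ drop (Suc a) p" by simp
    have ne: "p \<noteq> []" "drop a p \<noteq> []" "take (Suc a) p \<noteq> []" using False by auto
    \<comment> \<open>The pieces \<open>take (Suc a) p\<close> and \<open>drop a p\<close> overlap
      in the vertex \<open>p ! a\<close>, so that the first has exactly \<open>a\<close>
      edges.\<close>
    have suc: "successively (\<lambda>x y. {x, y} \<in> gedges \<Gamma>) (take (Suc a) p)"
      "successively (\<lambda>x y. {x, y} \<in> gedges \<Gamma>) (drop a p)"
      using p(1) unfolding walk_def
      by (metis append_take_drop_id successively_append_iff)+
    have hd: "hd (drop a p) = p ! a" "last (take (Suc a) p) = p ! a"
      using False by (auto simp: hd_drop_conv_nth take_Suc_conv_app_nth)
    have 1: "walk \<Gamma> u (take (Suc a) p) (p ! a)"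
      using p(1) suc(1) hd ne set_take_subset[of "Suc a" p] unfolding walk_def by auto
    have 2: "walk \<Gamma> (p ! a) (drop a p) v"
      using p(1) suc(2) hd ne set_drop_subset[of a p] unfolding walk_def by auto
    have "gdist \<Gamma> u (p ! a) \<le> enat a" "gdist \<Gamma> (p ! a) v \<le> enat b"
      using gdist_le_walk[OF 1] gdist_le_walk[OF 2] False p(2) assms
      by (auto elim!: order_trans)
    then show ?thesis
      using walk_hd_in[OF 2] by blast
  qed
qed

lemma gdist_le_in: "gdist \<Gamma> u v \<le> enat n \<Longrightarrow> v \<in> gverts \<Gamma>"
  by (metis gdist_le_imp_finite shortest_walk walk_hd_in walk_rev)

lemma gdist_le_1D:
  assumes "gdist \<Gamma> u v \<le> enat 1"
  shows "u = v \<or> {u, v} \<in> gedges \<Gamma>"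
proof -
  obtain p where p: "walk \<Gamma> u p v" "gdist \<Gamma> u v = enat (length p - 1)"
    by (rule shortest_walk[OF gdist_le_imp_finite[OF assms]])
  have "length p \<le> 2" using p(2) assms by simp
  then show ?thesis
    using p(1) by (cases p; cases "tl p") (auto simp: walk_singleton walk_Cons_Cons walk_def)
qed

lemma is_graph_rips: "is_graph (rips_graph k \<Lambda>)"
  unfolding is_graph_def rips_graph_def by auto

lemma edges_rips:
  "{u, v} \<in> gedges (rips_graph k \<Lambda>) \<longleftrightarrow>
    u \<in> gverts \<Lambda> \<and> v \<in> gverts \<Lambda> \<and> u \<noteq> v \<and> gdist \<Lambda> u v \<le> enat k"
  unfolding rips_graph_def by (auto simp: doubleton_eq_iff gdist_commute)

text \<open>A shortest walk in \<Lambda> is cut into \<open>n\<close> pieces of length at most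
  \<open>k\<close>, each of which is an edge of the Rips graph or trivial.\<close>

lemma gdist_rips:
  assumes "u \<in> gverts \<Lambda>" "v \<in> gverts \<Lambda>" "gdist \<Lambda> u v \<le> enat (k * n)"
  shows "gdist (rips_graph k \<Lambda>) u v \<le> enat n"
  using assms
proof (induction n arbitrary: u)
  case 0
  then have "u = v" using gdist_eq_0D[of \<Lambda> u v] by (simp flip: zero_enat_def)
  then show ?case using 0 gdist_refl[of v "rips_graph k \<Lambda>"] by (simp add: rips_graph_def)
next
  case (Suc n)
  then obtain w where w: "w \<in> gverts \<Lambda>" "gdist \<Lambda> u w \<le> enat k" "gdist \<Lambda> w v \<le> enat (k * n)"
    using gdist_split[of \<Lambda> u v k "k * n"] by auto
  have "gdist (rips_graph k \<Lambda>) u w \<le> enat 1"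
  proof (cases "u = w")
    case True
    then show ?thesis using Suc gdist_refl[of w "rips_graph k \<Lambda>"] by (simp add: rips_graph_def)
  next
    case False
    then show ?thesis
      using gdist_edge[OF is_graph_rips] Suc w edges_rips[of u w k \<Lambda>] by (simp add: one_enat_def)
  qed
  from gdist_triangle_le[OF this Suc.IH[OF w(1) Suc.prems(2) w(3)]] show ?case by simp
qed

text \<open>A walk that leaves \<open>\<Delta>\<close> has two consecutive edges at a vertex outside \<open>\<Delta>\<close>; their images
  have total length at most \<open>2 * B \<le> k\<close>, so in \<open>\<Delta>\<close> a single edge does the work of both.\<close>

lemma convex_subgraph_retraction:
  assumes \<Gamma>: "connected_graph \<Gamma>" and \<Delta>: "is_subgraph \<Delta> \<Gamma>"
    and full: "\<And>x y. \<lbrakk>x \<in> gverts \<Delta>; y \<in> gverts \<Delta>; {x, y} \<in> gedges \<Gamma>\<rbrakk> \<Longrightarrow> {x, y} \<in> gedges \<Delta>"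
    and \<pi>: "\<And>x. x \<in> gverts \<Gamma> \<Longrightarrow> \<pi> x \<in> gverts \<Lambda>"
    and short: "\<And>x y. {x, y} \<in> gedges \<Gamma> \<Longrightarrow> gdist \<Lambda> (\<pi> x) (\<pi> y) \<le> enat k"
    and contract: "\<And>x y. \<lbrakk>{x, y} \<in> gedges \<Gamma>; x \<notin> gverts \<Delta>\<rbrakk> \<Longrightarrow> gdist \<Lambda> (\<pi> x) (\<pi> y) \<le> enat B"
    and rips: "\<And>x y n. \<lbrakk>x \<in> gverts \<Delta>; y \<in> gverts \<Delta>; gdist \<Lambda> (\<pi> x) (\<pi> y) \<le> enat (k * n)\<rbrakk>
      \<Longrightarrow> gdist \<Delta> x y \<le> enat n"
    and B: "2 * B \<le> k"
  shows "convex_subgraph \<Delta> \<Gamma>"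
proof (rule convex_subgraphI[OF \<Gamma> \<Delta>])
  fix u v p
  assume uv: "u \<in> gverts \<Delta>" "v \<in> gverts \<Delta>" and p: "walk \<Gamma> u p v" "gdist \<Gamma> u v = enat (length p - 1)"
  have "set p \<subseteq> gverts \<Delta>"
  proof
    fix y assume "y \<in> set p"
    then obtain q r where p_eq: "p = q @ y # r" by (auto simp: in_set_conv_decomp)
    show "y \<in> gverts \<Delta>"
    proof (rule ccontr)
      assume y: "y \<notin> gverts \<Delta>"
      have ne: "q \<noteq> []" "r \<noteq> []"
        using p(1) uv y unfolding p_eq walk_def by auto
      let ?x = "last q" and ?z = "hd r"
      have w: "walk \<Gamma> u q ?x" "walk \<Gamma> ?z r v" "{y, ?x} \<in> gedges \<Gamma>" "{y, ?z} \<in> gedges \<Gamma>"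
        using p(1) ne unfolding p_eq walk_def
        by (auto simp: successively_append_iff successively_Cons insert_commute)
      have "gdist \<Lambda> (\<pi> u) (\<pi> ?x) \<le> enat (k * (length q - 1))"
        "gdist \<Lambda> (\<pi> ?z) (\<pi> v) \<le> enat (k * (length r - 1))"
        by (rule gdist_map_walk[OF \<pi> short]; use w in simp)+
      moreover have "gdist \<Lambda> (\<pi> ?x) (\<pi> y) \<le> enat B" "gdist \<Lambda> (\<pi> y) (\<pi> ?z) \<le> enat B"
        using contract[OF w(3) y] contract[OF w(4) y] by (simp_all add: gdist_commute)
      ultimately have "gdist \<Lambda> (\<pi> u) (\<pi> v) \<le>
          enat (k * (length q - 1) + (B + (B + k * (length r - 1))))"
        by (meson gdist_triangle_le)
      \<comment> \<open>The two edges at \<open>y\<close> are charged as one edge of length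
        \<open>k\<close>. The resulting count is one less than the number of edges of
        \<open>p\<close>, contrary to minimality.\<close>
      also have "\<dots> \<le> enat (k * (length q - 1 + (length r - 1) + 1))"
        using B by (simp add: algebra_simps)
      finally have "gdist \<Delta> u v \<le> enat (length q - 1 + (length r - 1) + 1)"
        by (rule rips[OF uv])
      then have "gdist \<Gamma> u v \<le> enat (length q - 1 + (length r - 1) + 1)"
        using gdist_subgraph[OF \<Delta>] order_trans by blast
      then show False
        using p(2) ne unfolding p_eq by (cases q; cases r) auto
    qed
  qed
  moreover from this have "successively (\<lambda>x y. {x, y} \<in> gedges \<Delta>) p"
    using p(1) full unfolding walk_def
    by (elim conjE, elim successively_mono) blast
  ultimately show "walk \<Delta> u p v"
    using p(1) unfolding walk_def by simp
qed

section \<open>Images of graphs under injective maps\<close>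

definition map_graph :: "('v \<Rightarrow> 'w) \<Rightarrow> 'v ugraph \<Rightarrow> 'w ugraph" where
  "map_graph f \<Gamma> = \<lparr>gverts = f ` gverts \<Gamma>, gedges = (`) f ` gedges \<Gamma>\<rparr>"

lemma verts_map_graph [simp]: "gverts (map_graph f \<Gamma>) = f ` gverts \<Gamma>"
  by (simp add: map_graph_def)

lemma edges_map_graph:
  assumes "is_graph \<Gamma>" "{x, y} \<in> gedges (map_graph f \<Gamma>)"
  obtains u v where "x = f u" "y = f v" "{u, v} \<in> gedges \<Gamma>"
proof -
  obtain e where e: "e \<in> gedges \<Gamma>" "{x, y} = f ` e"
    using assms(2) unfolding map_graph_def by auto
  then obtain a b where "e = {a, b}" using edge_obtain[OF assms(1)] by metis
  then show thesis using e that[of a b] that[of b a] by (auto simp: doubleton_eq_iff insert_commute)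
qed

lemma edges_map_graphI: "{u, v} \<in> gedges \<Gamma> \<Longrightarrow> {f u, f v} \<in> gedges (map_graph f \<Gamma>)"
  unfolding map_graph_def by (simp add: rev_image_eqI)

lemma is_graph_map_graph:
  assumes "is_graph \<Gamma>" "inj_on f (gverts \<Gamma>)"
  shows "is_graph (map_graph f \<Gamma>)"
  using assms unfolding is_graph_def map_graph_def
  by (auto simp: card_image inj_on_subset dest!: bspec)

lemma gdist_map_graph_le:
  assumes "is_graph \<Gamma>" "inj_on f (gverts \<Gamma>)"
  shows "gdist (map_graph f \<Gamma>) (f u) (f v) \<le> gdist \<Gamma> u v"
proof (cases "gdist \<Gamma> u v")
  case (enat n)
  have "gdist (map_graph f \<Gamma>) (f u) (f v) \<le> enat (1 * n)"
  proof (rule gdist_map[where \<Gamma> = \<Gamma>])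
    show "gdist (map_graph f \<Gamma>) (f x) (f y) \<le> enat 1" if "{x, y} \<in> gedges \<Gamma>" for x y
      using gdist_edge[OF is_graph_map_graph[OF assms] edges_map_graphI[OF that]]
      by (simp add: one_enat_def)
  qed (use enat in auto)
  then show ?thesis using enat by simp
qed simp

lemma connected_map_graph:
  assumes "connected_graph \<Gamma>" "inj_on f (gverts \<Gamma>)"
  shows "connected_graph (map_graph f \<Gamma>)"
proof -
  note g = graph_if_connected[OF assms(1)]
  obtain r where r: "r \<in> gverts \<Gamma>" using assms(1) unfolding connected_graph_def by auto
  show ?thesis
  proof (rule connected_graph_gdist[OF is_graph_map_graph[OF g assms(2)], of "f r"])
    fix x assume "x \<in> gverts (map_graph f \<Gamma>)"
    then obtain v where v: "v \<in> gverts \<Gamma>" "x = f v" by auto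
    then show "gdist (map_graph f \<Gamma>) (f r) x \<noteq> \<infinity>"
      using gdist_map_graph_le[OF g assms(2), of r v] gdist_finite[OF assms(1) r v(1)]
      by (metis enat_ord_simps(5))
  qed (use r in simp)
qed

lemma graph_isomorphic_map_graph:
  assumes "is_graph \<Gamma>" "inj_on f (gverts \<Gamma>)"
  shows "graph_isomorphic (map_graph f \<Gamma>) \<Gamma>"
proof -
  let ?g = "the_inv_into (gverts \<Gamma>) f"
  have "?g ` f ` e = e" if "e \<in> gedges \<Gamma>" for e
    using that assms the_inv_into_f_f[OF assms(2)] unfolding is_graph_def by (force simp: image_iff)
  then have "(\<lambda>e. ?g ` e) ` gedges (map_graph f \<Gamma>) = gedges \<Gamma>"
    by (simp add: map_graph_def image_comp)
  moreover have "bij_betw ?g (gverts (map_graph f \<Gamma>)) (gverts \<Gamma>)"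
    using bij_betw_the_inv_into[of f "gverts \<Gamma>"] assms(2) by (simp add: bij_betw_def)
  ultimately show ?thesis unfolding graph_isomorphic_def by blast
qed

lemma is_subgraph_map_graph:
  assumes "is_subgraph \<Delta> \<Gamma>" "inj_on f (gverts \<Gamma>)"
  shows "is_subgraph (map_graph f \<Delta>) (map_graph f \<Gamma>)"
  using assms is_graph_map_graph[of \<Delta> f] inj_on_subset[OF assms(2)]
  unfolding is_subgraph_def by (auto simp: map_graph_def)

section \<open>Cayley graphs\<close>

context group
begin

text \<open>The set \<open>K\<close> is not assumed symmetric, so an unordered edge may be
  multiplication by a generator in either direction.\<close>

lemma cayley_graph_edgeD:
  assumes "{x, y} \<in> gedges (cayley_graph G K)"
  shows "\<exists>s\<in>K. (x \<in> carrier G \<and> y = x \<otimes> s) \<or> (y \<in> carrier G \<and> x = y \<otimes> s)"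
proof -
  obtain g s where "g \<in> carrier G" "s \<in> K" "{x, y} = {g, g \<otimes> s}"
    using assms unfolding cayley_graph_def by auto
  then show ?thesis by (auto simp: doubleton_eq_iff)
qed

lemma cayley_graph_edgeI:
  "\<lbrakk>g \<in> carrier G; s \<in> K; s \<noteq> \<one>\<rbrakk> \<Longrightarrow> {g, g \<otimes> s} \<in> gedges (cayley_graph G K)"
  unfolding cayley_graph_def by auto

lemma verts_cayley_graph [simp]: "gverts (cayley_graph G K) = carrier G"
  by (simp add: cayley_graph_def)

lemma is_graph_cayley_graph:
  assumes "K \<subseteq> carrier G"
  shows "is_graph (cayley_graph G K)"
proof -
  have "g \<noteq> g \<otimes> s" if "g \<in> carrier G" "s \<in> K" "s \<noteq> \<one>" for g s
    using that assms l_cancel_one'[of g s] by auto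
  then show ?thesis
    using assms unfolding is_graph_def cayley_graph_def by auto
qed

lemma cayley_graph_edge_mult:
  assumes "K \<subseteq> carrier G" "a \<in> carrier G" "{x, y} \<in> gedges (cayley_graph G K)"
  shows "{a \<otimes> x, a \<otimes> y} \<in> gedges (cayley_graph G K)"
proof -
  obtain g s where s: "g \<in> carrier G" "s \<in> K" "s \<noteq> \<one>" "{x, y} = {g, g \<otimes> s}"
    using assms(3) unfolding cayley_graph_def by auto
  have "{a \<otimes> x, a \<otimes> y} = (\<otimes>) a ` {x, y}" by simp
  also have "\<dots> = {a \<otimes> g, a \<otimes> g \<otimes> s}"
    using s assms(1,2) by (auto simp: m_assoc)
  finally show ?thesis
    using cayley_graph_edgeI[of "a \<otimes> g" s K] s assms(2) by simp
qed

lemma gdist_cayley_graph_mult: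
  assumes "K \<subseteq> carrier G" "a \<in> carrier G"
  shows "gdist (cayley_graph G K) (a \<otimes> x) (a \<otimes> y) \<le> gdist (cayley_graph G K) x y"
proof (cases "gdist (cayley_graph G K) x y")
  case (enat n)
  have "gdist (cayley_graph G K) (a \<otimes> x) (a \<otimes> y) \<le> enat (1 * n)"
  proof (rule gdist_map[where f = "(\<otimes>) a" and \<Gamma> = "cayley_graph G K"])
    fix x y assume "{x, y} \<in> gedges (cayley_graph G K)"
    from gdist_edge[OF is_graph_cayley_graph cayley_graph_edge_mult[OF assms this]]
    show "gdist (cayley_graph G K) (a \<otimes> x) (a \<otimes> y) \<le> enat 1"
      using assms(1) by (simp add: one_enat_def)
  qed (use assms enat in auto)
  then show ?thesis using enat by simp
qed simp

lemma gdist_cayley_graph_one: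
  assumes "K \<subseteq> carrier G" "x \<in> carrier G" "y \<in> carrier G"
  shows "gdist (cayley_graph G K) x y = gdist (cayley_graph G K) \<one> (inv x \<otimes> y)"
proof (rule antisym)
  have "gdist (cayley_graph G K) (x \<otimes> \<one>) (x \<otimes> (inv x \<otimes> y)) \<le>
      gdist (cayley_graph G K) \<one> (inv x \<otimes> y)"
    by (rule gdist_cayley_graph_mult[OF assms(1,2)])
  then show "gdist (cayley_graph G K) x y \<le> gdist (cayley_graph G K) \<one> (inv x \<otimes> y)"
    using assms(2,3) by (simp add: m_assoc[symmetric])
  have "gdist (cayley_graph G K) (inv x \<otimes> x) (inv x \<otimes> y) \<le> gdist (cayley_graph G K) x y"
    by (rule gdist_cayley_graph_mult[OF assms(1)]) (use assms in simp)
  then show "gdist (cayley_graph G K) \<one> (inv x \<otimes> y) \<le> gdist (cayley_graph G K) x y"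
    using assms(2) by simp
qed

lemma connected_cayley_graph:
  assumes "K \<subseteq> carrier G" "carrier G \<subseteq> generate G K"
  shows "connected_graph (cayley_graph G K)"
proof -
  let ?C = "cayley_graph G K"
  note g = is_graph_cayley_graph[OF assms(1)]
  have step: "gdist ?C x (x \<otimes> h) \<noteq> \<infinity>" if "h \<in> K" "x \<in> carrier G" for x h
  proof (cases "h = \<one>")
    case True
    then show ?thesis using that gdist_refl[of x ?C] by simp
  next
    case False
    have "gdist ?C x (x \<otimes> h) \<le> enat 1"
      using gdist_edge[OF g cayley_graph_edgeI[OF that(2,1) False]] by (simp add: one_enat_def)
    then show ?thesis by (rule gdist_le_imp_finite)
  qed
  have "gdist ?C x (x \<otimes> h) \<noteq> \<infinity>" if "h \<in> generate G K" "x \<in> carrier G" for x h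
    using that
  proof (induction h arbitrary: x)
    case one
    then show ?case using gdist_refl[of x ?C] by simp
  next
    case (incl h)
    then show ?case using step by blast
  next
    case (inv h)
    have "h \<in> carrier G" using inv assms(1) by blast
    then show ?case
      using step[OF inv(1), of "x \<otimes> inv h"] inv(2) by (simp add: m_assoc gdist_commute)
  next
    case (eng h1 h2)
    have h: "h1 \<in> carrier G" "h2 \<in> carrier G"
      using eng generate_in_carrier[OF assms(1)] by blast+
    have "gdist ?C x (x \<otimes> h1) \<noteq> \<infinity>" "gdist ?C (x \<otimes> h1) (x \<otimes> h1 \<otimes> h2) \<noteq> \<infinity>"
      using eng h by simp_all
    then have "gdist ?C x (x \<otimes> h1 \<otimes> h2) \<noteq> \<infinity>"
      by (metis gdist_le_imp_finite gdist_triangle_le not_infinity_eq order_refl)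
    then show ?case using h eng.prems by (simp add: m_assoc)
  qed
  from this[of _ \<one>] have "gdist ?C \<one> v \<noteq> \<infinity>" if "v \<in> carrier G" for v
    using that assms(2) by (metis l_one one_closed subsetD)
  then show ?thesis
    by (intro connected_graph_gdist[OF g, of \<one>]) simp_all
qed

text \<open>Properness of the word metric. It yields both the finiteness of the enlarged generating
  set and the comparison of the metrics of a subgroup and of \<open>G\<close>.\<close>

lemma finite_ball_cayley_graph:
  assumes "finite K" "K \<subseteq> carrier G"
  shows "finite {x. gdist (cayley_graph G K) \<one> x \<le> enat n}"
proof (induction n)
  case 0
  have "{x. gdist (cayley_graph G K) \<one> x \<le> enat 0} \<subseteq> {\<one>}"
    using gdist_eq_0D[of "cayley_graph G K" \<one>] by (auto simp flip: zero_enat_def)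
  then show ?case using finite_subset by blast
next
  case (Suc n)
  let ?B = "{x. gdist (cayley_graph G K) \<one> x \<le> enat n}"
  have "{x. gdist (cayley_graph G K) \<one> x \<le> enat (Suc n)} \<subseteq>
    ?B \<union> (\<lambda>(x, s). x \<otimes> s) ` (?B \<times> K) \<union> (\<lambda>(x, s). x \<otimes> inv s) ` (?B \<times> K)"
  proof
    fix x assume "x \<in> {x. gdist (cayley_graph G K) \<one> x \<le> enat (Suc n)}"
    then obtain w where w: "w \<in> ?B" "gdist (cayley_graph G K) w x \<le> enat 1"
      using gdist_split[of "cayley_graph G K" \<one> x n 1] by auto
    from gdist_le_1D[OF w(2)] consider "w = x" | "{w, x} \<in> gedges (cayley_graph G K)" by blast
    then show "x \<in> ?B \<union> (\<lambda>(x, s). x \<otimes> s) ` (?B \<times> K) \<union> (\<lambda>(x, s). x \<otimes> inv s) ` (?B \<times> K)"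
    proof cases
      case 2
      from cayley_graph_edgeD[OF this] obtain s where s: "s \<in> K"
        "x = w \<otimes> s \<or> (x \<in> carrier G \<and> w = x \<otimes> s)" by blast
      then have "x = w \<otimes> s \<or> x = w \<otimes> inv s"
        using assms(2) by (auto simp: m_assoc)
      then show ?thesis using w(1) s(1) by (auto intro!: image_eqI)
    qed (use w in simp)
  qed
  then show ?case using Suc assms(1) 
    by (elim finite_subset) simp
qed

text \<open>A coset graph is a left translate of the Cayley graph of the subgroup, from which it
  inherits connectedness.\<close>

lemma coset_graph_eq_map_graph:
  assumes "subgroup H G" "T \<subseteq> H" "g \<in> carrier G"
  shows "coset_graph G g H T = map_graph ((\<otimes>) g) (cayley_graph (G\<lparr>carrier := H\<rparr>) T)"
proof -
  let ?P = "H \<times> (T - {\<one>})"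
  have "gedges (coset_graph G g H T) = (\<lambda>(h, s). {g \<otimes> h, g \<otimes> h \<otimes> s}) ` ?P"
    unfolding coset_graph_def by auto
  also have "\<dots> = (\<lambda>(h, s). (\<otimes>) g ` {h, h \<otimes> s}) ` ?P"
    by (rule image_cong) (use assms subgroup.mem_carrier[OF assms(1)] in \<open>auto simp: m_assoc\<close>)
  also have "\<dots> = (`) ((\<otimes>) g) ` (\<lambda>(h, s). {h, h \<otimes> s}) ` ?P"
    by (simp add: image_image case_prod_unfold)
  also have "(\<lambda>(h, s). {h, h \<otimes> s}) ` ?P = gedges (cayley_graph (G\<lparr>carrier := H\<rparr>) T)"
    unfolding cayley_graph_def by auto
  finally show ?thesis
    by (simp add: map_graph_def coset_graph_def cayley_graph_def l_coset_def UNION_singleton_eq_range)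
qed

lemma coset_graph_subgraph:
  assumes "subgroup H G" "finite_generating_set G H T" "T \<subseteq> S" "S \<subseteq> carrier G" "g \<in> carrier G"
  shows "connected_graph (coset_graph G g H T)"
    and "is_subgraph (coset_graph G g H T) (cayley_graph G S)"
proof -
  interpret H: group "G\<lparr>carrier := H\<rparr>" by (rule subgroup.subgroup_is_group[OF assms(1) is_group])
  have T: "T \<subseteq> H" "generate G T = H" using assms(2) by (auto simp: finite_generating_set_def)
  note HG = subgroup.mem_carrier[OF assms(1)]
  have "connected_graph (cayley_graph (G\<lparr>carrier := H\<rparr>) T)"
    using T generate_consistent[OF T(1) assms(1)] by (intro H.connected_cayley_graph) auto
  then show c: "connected_graph (coset_graph G g H T)"
    unfolding coset_graph_eq_map_graph[OF assms(1) T(1) assms(5)]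
    using HG assms(5) by (intro connected_map_graph) (auto simp: inj_on_def cayley_graph_def)
  show "is_subgraph (coset_graph G g H T) (cayley_graph G S)"
    unfolding is_subgraph_def
  proof (intro conjI)
    show "gedges (coset_graph G g H T) \<subseteq> gedges (cayley_graph G S)"
    proof
      fix e assume "e \<in> gedges (coset_graph G g H T)"
      then obtain h s where "h \<in> H" "s \<in> T" "s \<noteq> \<one>" "e = {g \<otimes> h, g \<otimes> h \<otimes> s}"
        unfolding coset_graph_def by auto
      then show "e \<in> gedges (cayley_graph G S)"
        using cayley_graph_edgeI[of "g \<otimes> h" s S] HG assms(3,5) by auto
    qed
    show "is_graph (coset_graph G g H T)" by (rule graph_if_connected[OF c])
    show "gverts (coset_graph G g H T) \<subseteq> gverts (cayley_graph G S)"
      using HG assms(5) by (auto simp: coset_graph_def l_coset_def)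
  qed
qed

text \<open>Recognizes when the coset containing an added edge is the subgroup \<open>H\<close>
  itself: the edge then comes from the same subgroup and is a Rips edge of it.\<close>

lemma l_coset_eq_subgroup:
  assumes "subgroup A G" "subgroup H G" "g \<in> carrier G" "g <# A = H"
  shows "A = H" "g \<in> H"
proof -
  show g: "g \<in> H"
    using subgroup.one_closed[OF assms(1)] assms(3,4) unfolding l_coset_def by force
  show "A = H"
  proof
    show "A \<subseteq> H"
    proof
      fix x assume x: "x \<in> A"
      then have "g \<otimes> x \<in> H"
        unfolding assms(4)[symmetric] l_coset_def by auto
      then have "inv g \<otimes> (g \<otimes> x) \<in> H"
        by (rule subgroup.m_closed[OF assms(2) subgroup.m_inv_closed[OF assms(2) g]])
      then show "x \<in> H"
        using x assms(3) subgroup.mem_carrier[OF assms(1)] by (simp add: m_assoc[symmetric])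
    qed
    show "H \<subseteq> A"
    proof
      fix x assume x: "x \<in> H"
      then have "g \<otimes> x \<in> g <# A"
        unfolding assms(4) by (intro subgroup.m_closed[OF assms(2)] g)
      then show "x \<in> A"
        using x assms(3) subgroup.mem_carrier[OF assms(1)] subgroup.mem_carrier[OF assms(2)]
        unfolding l_coset_def by auto
    qed
  qed
qed

text \<open>One free orbit suffices, so all vertices carry the tag 0. The restriction to the vertex
  set is there because members of \<open>Bij\<close> are extensional.\<close>

definition tag_action :: "'a \<Rightarrow> 'a \<times> nat \<Rightarrow> 'a \<times> nat" where
  "tag_action g = (\<lambda>p\<in>carrier G \<times> {0}. (g \<otimes> fst p, 0))"

abbreviation (input) tag :: "'a \<Rightarrow> 'a \<times> nat" where
  "tag x \<equiv> (x, 0)"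

lemma tag_action [simp]: "x \<in> carrier G \<Longrightarrow> tag_action g (x, 0) = (g \<otimes> x, 0)"
  by (simp add: tag_action_def)

lemma tag_action_Bij: "g \<in> carrier G \<Longrightarrow> tag_action g \<in> Bij (carrier G \<times> {0})"
  unfolding Bij_def
proof (intro IntI CollectI)
  assume g: "g \<in> carrier G"
  show "bij_betw (tag_action g) (carrier G \<times> {0}) (carrier G \<times> {0})"
    by (rule bij_betw_byWitness[where f' = "tag_action (inv g)"])
      (use g in \<open>auto simp: m_assoc[symmetric]\<close>)
qed (simp add: tag_action_def)

lemma group_action_tag_action: "group_action G (carrier G \<times> {0}) tag_action"
proof (rule group_action.intro, rule group_hom.intro[OF is_group group_BijGroup],
    rule group_hom_axioms.intro, rule homI)
  fix g h assume gh: "g \<in> carrier G" "h \<in> carrier G"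
  have "tag_action (g \<otimes> h) = compose (carrier G \<times> {0}) (tag_action g) (tag_action h)"
    by (rule ext) (use gh in \<open>auto simp: tag_action_def compose_def m_assoc\<close>)
  then show "tag_action (g \<otimes> h) = tag_action g \<otimes>\<^bsub>BijGroup (carrier G \<times> {0})\<^esub> tag_action h"
    using gh tag_action_Bij by (simp add: BijGroup_def)
qed (use tag_action_Bij in \<open>simp add: BijGroup_def\<close>)

text \<open>Used both for \<open>G\<close> on the whole graph and for \<open>H i\<close> on its Rips
  graph. Vertices form a single free orbit; translating an end of an edge to the unit represents its
  orbit by \<open>{\<one>, c}\<close> with \<open>c\<close> in the finite set \<open>C\<close>. The
  disjunction reflects that edges are unordered.\<close>

lemma tag_action_graph:
  assumes A: "subgroup A G" and \<Theta>: "is_graph \<Theta>" "gverts \<Theta> = A"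
    and inv: "\<And>a x y. \<lbrakk>a \<in> A; {x, y} \<in> gedges \<Theta>\<rbrakk> \<Longrightarrow> {a \<otimes> x, a \<otimes> y} \<in> gedges \<Theta>"
    and C: "finite C" "\<And>x y. {x, y} \<in> gedges \<Theta> \<Longrightarrow> x \<in> A \<Longrightarrow> y \<in> A \<Longrightarrow> inv x \<otimes> y \<in> C \<or> inv y \<otimes> x \<in> C"
  shows "stabilizes A tag_action (map_graph tag \<Theta>)"
    and "free_action (G\<lparr>carrier := A\<rparr>) (map_graph tag \<Theta>) tag_action"
    and "cocompact_action (G\<lparr>carrier := A\<rparr>) (map_graph tag \<Theta>) tag_action"
proof -
  note mem = subgroup.mem_carrier[OF A] and cl = subgroup.m_closed[OF A]
    and icl = subgroup.m_inv_closed[OF A]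
  have sub: "tag_action h ` gverts (map_graph tag \<Theta>) \<subseteq> gverts (map_graph tag \<Theta>)"
    "(\<lambda>e. tag_action h ` e) ` gedges (map_graph tag \<Theta>) \<subseteq> gedges (map_graph tag \<Theta>)"
    if h: "h \<in> A" for h
  proof -
    show "tag_action h ` gverts (map_graph tag \<Theta>) \<subseteq> gverts (map_graph tag \<Theta>)"
      using \<Theta>(2) cl h mem by auto
    show "(\<lambda>e. tag_action h ` e) ` gedges (map_graph tag \<Theta>) \<subseteq> gedges (map_graph tag \<Theta>)"
    proof (rule image_subsetI)
      fix e assume "e \<in> gedges (map_graph tag \<Theta>)"
      then obtain e' where e': "e' \<in> gedges \<Theta>" "e = tag ` e'" unfolding map_graph_def by auto
      obtain u v where uv: "e' = {u, v}" using edge_obtain[OF \<Theta>(1) e'(1)] by metis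
      have "u \<in> A" "v \<in> A" using edge_in[OF \<Theta>(1)] e' uv \<Theta>(2) by auto
      then have "tag_action h ` e = {tag (h \<otimes> u), tag (h \<otimes> v)}" using e' uv mem by simp
      then show "tag_action h ` e \<in> gedges (map_graph tag \<Theta>)"
        using edges_map_graphI[OF inv[OF h, of u v], of tag] e' uv by simp
    qed
  qed
  have id: "tag_action h (tag_action (inv h) p) = p" if "h \<in> A" "p \<in> tag ` A" for h p
    using that mem by (auto simp: m_assoc[symmetric])
  show "stabilizes A tag_action (map_graph tag \<Theta>)"
    unfolding stabilizes_def
  proof (intro ballI conjI antisym)
    fix h assume h: "h \<in> A"
    show "gverts (map_graph tag \<Theta>) \<subseteq> tag_action h ` gverts (map_graph tag \<Theta>)"
    proof
      fix p assume p: "p \<in> gverts (map_graph tag \<Theta>)"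
      then have "p = tag_action h (tag_action (inv h) p)" using id[OF h] \<Theta>(2) by simp
      then show "p \<in> tag_action h ` gverts (map_graph tag \<Theta>)"
        using sub(1)[OF icl[OF h]] p by (metis image_subset_iff image_eqI)
    qed
    show "gedges (map_graph tag \<Theta>) \<subseteq> (\<lambda>e. tag_action h ` e) ` gedges (map_graph tag \<Theta>)"
    proof
      fix e assume e: "e \<in> gedges (map_graph tag \<Theta>)"
      then have "e \<subseteq> tag ` A" using \<Theta> unfolding map_graph_def is_graph_def by auto
      then have "tag_action h ` tag_action (inv h) ` e = (\<lambda>p. p) ` e"
        unfolding image_image by (intro image_cong id[OF h]) auto
      then have "tag_action h ` tag_action (inv h) ` e = e" by simp
      then show "e \<in> (\<lambda>e. tag_action h ` e) ` gedges (map_graph tag \<Theta>)"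
        using sub(2)[OF icl[OF h]] e by (metis image_subset_iff rev_image_eqI)
    qed
  qed (use sub in auto)
  show "free_action (G\<lparr>carrier := A\<rparr>) (map_graph tag \<Theta>) tag_action"
    using \<Theta>(2) mem subgroup.one_closed[OF A]
    unfolding free_action_def stabilizer_def by (auto simp: l_cancel_one)
  have orb: "orbit (G\<lparr>carrier := A\<rparr>) (\<lambda>g e. tag_action g ` e) (tag ` {x, y}) =
      orbit (G\<lparr>carrier := A\<rparr>) (\<lambda>g e. tag_action g ` e) (tag ` {\<one>, inv x \<otimes> y})"
    (is "?L = ?R") if xy: "x \<in> A" "y \<in> A" for x y
  proof -
    have *: "tag_action g ` tag ` {x, y} = tag_action (g \<otimes> x) ` tag ` {\<one>, inv x \<otimes> y}"
      if "g \<in> A" for g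
      using that xy mem by (simp add: m_assoc[symmetric]) (simp add: m_assoc)
    show ?thesis
    proof
      show "?L \<subseteq> ?R"
      proof
        fix e assume "e \<in> ?L"
        then obtain g where g: "g \<in> A" "e = tag_action g ` tag ` {x, y}"
          unfolding orbit_def by auto
        then show "e \<in> ?R"
          unfolding orbit_def mem_Collect_eq *[OF g(1)] using cl[OF g(1) xy(1)] by auto
      qed
      show "?R \<subseteq> ?L"
      proof
        fix e assume "e \<in> ?R"
        then obtain g where g: "g \<in> A" "e = tag_action g ` tag ` {\<one>, inv x \<otimes> y}"
          unfolding orbit_def by auto
        then have "e = tag_action (g \<otimes> inv x) ` tag ` {x, y}"
          using *[of "g \<otimes> inv x"] xy mem cl icl by (simp add: m_assoc)
        then show "e \<in> ?L" using g xy cl icl unfolding orbit_def by auto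
      qed
    qed
  qed
  have "orbits (G\<lparr>carrier := A\<rparr>) (gedges (map_graph tag \<Theta>)) (\<lambda>g e. tag_action g ` e) \<subseteq>
    (\<lambda>c. orbit (G\<lparr>carrier := A\<rparr>) (\<lambda>g e. tag_action g ` e) (tag ` {\<one>, c})) ` C"
  proof
    fix E assume "E \<in> orbits (G\<lparr>carrier := A\<rparr>) (gedges (map_graph tag \<Theta>)) (\<lambda>g e. tag_action g ` e)"
    then obtain e where e: "e \<in> gedges \<Theta>"
      "E = orbit (G\<lparr>carrier := A\<rparr>) (\<lambda>g e. tag_action g ` e) (tag ` e)"
      unfolding orbits_def map_graph_def by auto
    obtain u v where uv: "e = {u, v}" using edge_obtain[OF \<Theta>(1) e(1)] by metis
    have uvA: "u \<in> A" "v \<in> A" using edge_in[OF \<Theta>(1)] e uv \<Theta>(2) by auto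
    have vu: "e = {v, u}" using uv by auto
    have "inv u \<otimes> v \<in> C \<or> inv v \<otimes> u \<in> C" using C(2)[of u v] e(1) uv uvA by simp
    then show "E \<in> (\<lambda>c. orbit (G\<lparr>carrier := A\<rparr>) (\<lambda>g e. tag_action g ` e) (tag ` {\<one>, c})) ` C"
    proof
      assume "inv u \<otimes> v \<in> C"
      then show ?thesis unfolding e(2) uv orb[OF uvA] by (rule imageI)
    next
      assume "inv v \<otimes> u \<in> C"
      then show ?thesis unfolding e(2) vu orb[OF uvA(2,1)] by (rule imageI)
    qed
  qed
  moreover have "orbits (G\<lparr>carrier := A\<rparr>) (gverts (map_graph tag \<Theta>)) tag_action \<subseteq> {tag ` A}"
  proof
    fix E assume "E \<in> orbits (G\<lparr>carrier := A\<rparr>) (gverts (map_graph tag \<Theta>)) tag_action"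
    then obtain x where x: "x \<in> A" "E = {tag (g \<otimes> x) | g. g \<in> A}"
      unfolding orbits_def orbit_def using \<Theta>(2) mem by auto
    have "y = (y \<otimes> inv x) \<otimes> x \<and> y \<otimes> inv x \<in> A" if "y \<in> A" for y
      using that x(1) mem cl icl by (simp add: m_assoc)
    then have "E = tag ` A"
      using x(2) cl[OF _ x(1)] by blast
    then show "E \<in> {tag ` A}" by simp
  qed
  ultimately show "cocompact_action (G\<lparr>carrier := A\<rparr>) (map_graph tag \<Theta>) tag_action"
    unfolding cocompact_action_def using C(1) by (meson finite.emptyI finite.insertI finite_imageI finite_subset)
qed

section \<open>Word metrics of subgroups\<close>

lemma cayley_graph_subgroup:
  assumes "subgroup H G" "finite_generating_set G H S"
  defines "\<Lambda> \<equiv> cayley_graph (G\<lparr>carrier := H\<rparr>) S"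
  shows "connected_graph \<Lambda>" "gverts \<Lambda> = H"
    and "\<lbrakk>x \<in> H; y \<in> H\<rbrakk> \<Longrightarrow> gdist \<Lambda> x y = gdist \<Lambda> \<one> (inv x \<otimes> y)"
    and "a \<in> H \<Longrightarrow> gdist \<Lambda> (a \<otimes> x) (a \<otimes> y) \<le> gdist \<Lambda> x y"
    and "finite {x. gdist \<Lambda> \<one> x \<le> enat n}"
proof -
  interpret H: group "G\<lparr>carrier := H\<rparr>" by (rule subgroup.subgroup_is_group[OF assms(1) is_group])
  have S: "S \<subseteq> H" "generate G S = H" "finite S"
    using assms(2) by (auto simp: finite_generating_set_def)
  show "gverts \<Lambda> = H" by (simp add: \<Lambda>_def)
  show "connected_graph \<Lambda>"
    unfolding \<Lambda>_def using generate_consistent[OF S(1) assms(1)] S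
    by (intro H.connected_cayley_graph) auto
  show "gdist \<Lambda> x y = gdist \<Lambda> \<one> (inv x \<otimes> y)" if "x \<in> H" "y \<in> H"
    unfolding \<Lambda>_def using H.gdist_cayley_graph_one[of S x y] S that assms(1) by simp
  show "gdist \<Lambda> (a \<otimes> x) (a \<otimes> y) \<le> gdist \<Lambda> x y" if "a \<in> H"
    unfolding \<Lambda>_def using H.gdist_cayley_graph_mult[of S a x y] S that by simp
  show "finite {x. gdist \<Lambda> \<one> x \<le> enat n}"
    unfolding \<Lambda>_def using H.finite_ball_cayley_graph[of S n] S by simp
qed

text \<open>By left invariance one point may be taken to be the unit. The other then ranges over a
  finite set, and \<open>M\<close> is the largest distance that occurs.\<close>

lemma subgroup_distortion:
  assumes "subgroup H G" "finite_generating_set G H T" "finite S" "S \<subseteq> carrier G"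
  shows "\<exists>M. \<forall>x\<in>H. \<forall>y\<in>H. gdist (cayley_graph G S) x y \<le> enat B \<longrightarrow>
    gdist (cayley_graph (G\<lparr>carrier := H\<rparr>) T) x y \<le> enat M"
proof -
  let ?\<Lambda> = "cayley_graph (G\<lparr>carrier := H\<rparr>) T"
  note \<Lambda> = cayley_graph_subgroup[OF assms(1,2)]
  let ?F = "{x \<in> H. gdist (cayley_graph G S) \<one> x \<le> enat B}"
  have "finite ?F"
    using finite_ball_cayley_graph[OF assms(3,4), of B] by (rule rev_finite_subset) auto
  then have "finite ((\<lambda>x. the_enat (gdist ?\<Lambda> \<one> x)) ` ?F)" by simp
  then obtain M where M: "\<And>x. x \<in> ?F \<Longrightarrow> the_enat (gdist ?\<Lambda> \<one> x) \<le> M"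
    unfolding finite_nat_set_iff_bounded_le by blast
  have "gdist ?\<Lambda> x y \<le> enat M"
    if xy: "x \<in> H" "y \<in> H" and le: "gdist (cayley_graph G S) x y \<le> enat B" for x y
  proof -
    have z: "inv x \<otimes> y \<in> H"
      using xy subgroup.m_closed[OF assms(1)] subgroup.m_inv_closed[OF assms(1)] by blast
    moreover have "gdist (cayley_graph G S) \<one> (inv x \<otimes> y) \<le> enat B"
      using le gdist_cayley_graph_one[OF assms(4), of x y] xy subgroup.mem_carrier[OF assms(1)] by simp
    moreover have "gdist ?\<Lambda> \<one> (inv x \<otimes> y) \<noteq> \<infinity>"
      using gdist_finite[OF \<Lambda>(1)] z subgroup.one_closed[OF assms(1)] \<Lambda>(2) by simp
    ultimately show ?thesis
      using M[of "inv x \<otimes> y"] \<Lambda>(3)[OF xy] by auto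
  qed
  then show ?thesis by blast
qed

section \<open>Construction of the graph and convexity of the Rips graphs\<close>

lemma convex_rips_graphs:
  fixes I :: "'i set" and H S :: "'i \<Rightarrow> 'a set"
  assumes I: "finite I" and subgroup_H: "\<And>i. i \<in> I \<Longrightarrow> subgroup (H i) G"
    and rel_hyp: "rel_hyperbolic_group G I H"
    and S: "\<And>i. i \<in> I \<Longrightarrow> finite_generating_set G (H i) (S i)"
    and S_eq: "\<And>i j. i \<in> I \<Longrightarrow> j \<in> I \<Longrightarrow> H i = H j \<Longrightarrow> S i = S j"
  shows "\<exists>(\<Gamma> :: ('a \<times> nat) ugraph) \<phi> \<Gamma>s.
    connected_graph \<Gamma> \<and> graph_action G \<Gamma> \<phi> \<and> free_action G \<Gamma> \<phi> \<and> cocompact_action G \<Gamma> \<phi> \<and>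
    (\<forall>i\<in>I. is_subgraph (\<Gamma>s i) \<Gamma> \<and>
       (\<exists>k. graph_isomorphic (\<Gamma>s i) (rips_graph k (cayley_graph (G\<lparr>carrier := H i\<rparr>) (S i)))) \<and>
       stabilizes (H i) \<phi> (\<Gamma>s i) \<and>
       free_action (G\<lparr>carrier := H i\<rparr>) (\<Gamma>s i) \<phi> \<and>
       cocompact_action (G\<lparr>carrier := H i\<rparr>) (\<Gamma>s i) \<phi> \<and>
       convex_subgraph (\<Gamma>s i) \<Gamma>)"
proof -
  obtain T S\<^sub>0 where T: "\<And>i. i \<in> I \<Longrightarrow> finite_generating_set G (H i) (T i) \<and> T i \<subseteq> S\<^sub>0"
    and S\<^sub>0: "finite_generating_set G (carrier G) S\<^sub>0"
    and hyp: "rel_hyperbolic_graph (cayley_graph G S\<^sub>0)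
      {coset_graph G g (H i) (T i) | g i. g \<in> carrier G \<and> i \<in> I}"
    using rel_hyp unfolding rel_hyperbolic_group_def by blast
  define \<L> where "\<L> = {coset_graph G g (H i) (T i) | g i. g \<in> carrier G \<and> i \<in> I}"
  have S\<^sub>0': "finite S\<^sub>0" "S\<^sub>0 \<subseteq> carrier G" "generate G S\<^sub>0 = carrier G"
    using S\<^sub>0 by (auto simp: finite_generating_set_def)
  interpret subgraph_family "cayley_graph G S\<^sub>0" \<L>
  proof
    show "connected_graph (cayley_graph G S\<^sub>0)"
      using S\<^sub>0' by (intro connected_cayley_graph) auto
    show "connected_graph \<Lambda> \<and> is_subgraph \<Lambda> (cayley_graph G S\<^sub>0)" if \<Lambda>: "\<Lambda> \<in> \<L>" for \<Lambda>
    proof -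
      obtain g i where "\<Lambda> = coset_graph G g (H i) (T i)" "g \<in> carrier G" "i \<in> I"
        using \<Lambda> unfolding \<L>_def by blast
      then show ?thesis
        using coset_graph_subgraph[OF subgroup_H _ _ S\<^sub>0'(2)] T by simp
    qed
  qed
  obtain B where B: "\<forall>\<Lambda>\<in>\<L>. \<exists>\<pi>. contracting_retraction (cayley_graph G S\<^sub>0) \<L> B \<Lambda> \<pi>"
    using contracting_retraction_exists[OF hyp[folded \<L>_def]] by blast
  define \<Lambda> where "\<Lambda> i = cayley_graph (G\<lparr>carrier := H i\<rparr>) (S i)" for i
  note \<Lambda> = cayley_graph_subgroup[OF subgroup_H S, folded \<Lambda>_def]
  have "\<forall>i\<in>I. \<exists>M. \<forall>x\<in>H i. \<forall>y\<in>H i. gdist (cayley_graph G S\<^sub>0) x y \<le> enat B \<longrightarrow>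
      gdist (\<Lambda> i) x y \<le> enat M"
    unfolding \<Lambda>_def using subgroup_distortion[OF subgroup_H S S\<^sub>0'(1,2)] by blast
  from bchoice[OF this] obtain M where M: "\<And>i x y. \<lbrakk>i \<in> I; x \<in> H i; y \<in> H i;
      gdist (cayley_graph G S\<^sub>0) x y \<le> enat B\<rbrakk> \<Longrightarrow> gdist (\<Lambda> i) x y \<le> enat (M i)"
    by blast
  \<comment> \<open>A single parameter for all subgroups: the sum dominates every
    \<open>M i\<close>, and the factor 2 pays for the two edges at a vertex outside.\<close>
  define k where "k = 2 * (\<Sum>i\<in>I. M i)"
  have k: "2 * M i \<le> k" if "i \<in> I" for i
    unfolding k_def using member_le_sum[OF that, of M] I by simp
  \<comment> \<open>Multiplying \<open>x\<close> by nontrivial elements of the \<open>k\<close>-ball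
    of \<open>H j\<close> yields the Rips edges at \<open>x\<close> in the coset of
    \<open>x\<close>; \<open>S\<^sub>0\<close> keeps the graph connected.\<close>
  define K where "K = S\<^sub>0 \<union> (\<Union>j\<in>I. {x. gdist (\<Lambda> j) \<one> x \<le> enat k})"
  have ball: "x \<in> H j" if "j \<in> I" "gdist (\<Lambda> j) \<one> x \<le> enat k" for j x
    using gdist_le_in[OF that(2)] \<Lambda>(2)[OF that(1) that(1)] by simp
  have K: "finite K" "K \<subseteq> carrier G"
    using S\<^sub>0' I \<Lambda>(5) ball subgroup.mem_carrier[OF subgroup_H] unfolding K_def by auto
  have carrier_K: "carrier G \<subseteq> generate G K"
    using mono_generate[of S\<^sub>0 K] S\<^sub>0'(3) unfolding K_def by blast
  let ?\<Gamma>\<^sub>0 = "cayley_graph G K"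
  let ?R = "\<lambda>i. rips_graph k (\<Lambda> i)"
  define \<Gamma> where "\<Gamma> = map_graph tag ?\<Gamma>\<^sub>0"
  define \<Gamma>s where "\<Gamma>s i = map_graph tag (?R i)" for i
  have inj: "inj_on tag A" for A :: "'a set" by (simp add: inj_on_def)
  have conn_\<Gamma>: "connected_graph \<Gamma>"
    unfolding \<Gamma>_def by (intro connected_map_graph connected_cayley_graph K carrier_K inj)
  have g\<Gamma>\<^sub>0: "is_graph ?\<Gamma>\<^sub>0" by (rule is_graph_cayley_graph[OF K(2)])
  have verts_R: "gverts (?R i) = H i" if "i \<in> I" for i
    using \<Lambda>(2)[OF that that] by (simp add: rips_graph_def)
  have act: "stabilizes (carrier G) tag_action \<Gamma>" "free_action G \<Gamma> tag_action"
    "cocompact_action G \<Gamma> tag_action"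
  proof -
    have "inv x \<otimes> y \<in> K \<or> inv y \<otimes> x \<in> K"
      if "{x, y} \<in> gedges ?\<Gamma>\<^sub>0" "x \<in> carrier G" "y \<in> carrier G" for x y
      using cayley_graph_edgeD[OF that(1)] K(2) that by (auto simp: m_assoc[symmetric])
    note * = tag_action_graph[OF subgroup_self g\<Gamma>\<^sub>0 _ cayley_graph_edge_mult[OF K(2)] K(1) this,
        simplified, folded \<Gamma>_def]
    show "stabilizes (carrier G) tag_action \<Gamma>" "free_action G \<Gamma> tag_action"
      "cocompact_action G \<Gamma> tag_action"
      using * by simp_all
  qed
  have graph_action: "graph_action G \<Gamma> tag_action"
  proof -
    have "gverts \<Gamma> = carrier G \<times> {0}" by (auto simp: \<Gamma>_def)
    then show ?thesis
      using act(1) group_action_tag_action by (simp add: graph_action_def stabilizes_def)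
  qed
  have sub_R: "is_subgraph (?R i) ?\<Gamma>\<^sub>0" if i: "i \<in> I" for i
    unfolding is_subgraph_def
  proof (intro conjI subsetI)
    fix e assume e: "e \<in> gedges (?R i)"
    then obtain x y where xy: "e = {x, y}" "x \<noteq> y" using edge_obtain[OF is_graph_rips] by metis
    then have *: "x \<in> H i" "y \<in> H i" "gdist (\<Lambda> i) x y \<le> enat k"
      using e \<Lambda>(2)[OF i i] by (auto simp: edges_rips)
    then have c: "x \<in> carrier G" "y \<in> carrier G" using subgroup.mem_carrier[OF subgroup_H[OF i]] by auto
    have "inv x \<otimes> y \<in> K" using * \<Lambda>(3)[OF i i] i unfolding K_def by auto
    moreover have "inv x \<otimes> y \<noteq> \<one>" using c xy(2) by (metis inv_solve_left one_closed r_one)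
    ultimately show "e \<in> gedges ?\<Gamma>\<^sub>0"
      using cayley_graph_edgeI[of x "inv x \<otimes> y" K] c xy(1) by (simp add: m_assoc[symmetric])
  qed (use is_graph_rips verts_R[OF i] subgroup.mem_carrier[OF subgroup_H[OF i]] in auto)
  have act_H: "stabilizes (H i) tag_action (\<Gamma>s i) \<and>
      free_action (G\<lparr>carrier := H i\<rparr>) (\<Gamma>s i) tag_action \<and>
      cocompact_action (G\<lparr>carrier := H i\<rparr>) (\<Gamma>s i) tag_action" if i: "i \<in> I" for i
  proof -
    have 1: "{a \<otimes> x, a \<otimes> y} \<in> gedges (?R i)" if "a \<in> H i" "{x, y} \<in> gedges (?R i)" for a x y
      using that order_trans[OF \<Lambda>(4)[OF i i that(1), of x y]] \<Lambda>(2)[OF i i]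
        subgroup.m_closed[OF subgroup_H[OF i]] subgroup.mem_carrier[OF subgroup_H[OF i]]
      by (auto simp: edges_rips)
    have 2: "inv x \<otimes> y \<in> {z. gdist (\<Lambda> i) \<one> z \<le> enat k} \<or> inv y \<otimes> x \<in> {z. gdist (\<Lambda> i) \<one> z \<le> enat k}"
      if "{x, y} \<in> gedges (?R i)" "x \<in> H i" "y \<in> H i" for x y
      using that \<Lambda>(3)[OF i i that(2,3)] by (simp add: edges_rips)
    note * = tag_action_graph[OF subgroup_H[OF i] is_graph_rips verts_R[OF i] 1 \<Lambda>(5)[OF i i] 2,
        folded \<Gamma>s_def]
    show ?thesis using * by simp
  qed
  have convex: "convex_subgraph (\<Gamma>s i) \<Gamma>" if i: "i \<in> I" for i
  proof -
    define \<Lambda>\<^sub>i where "\<Lambda>\<^sub>i = coset_graph G \<one> (H i) (T i)"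
    have \<Lambda>\<^sub>i: "\<Lambda>\<^sub>i \<in> \<L>" "gverts \<Lambda>\<^sub>i = H i"
    proof -
      show "\<Lambda>\<^sub>i \<in> \<L>" using i unfolding \<L>_def \<Lambda>\<^sub>i_def by blast
      show "gverts \<Lambda>\<^sub>i = H i"
        using lcos_mult_one[OF subgroup.subset[OF subgroup_H[OF i]]]
        by (simp add: \<Lambda>\<^sub>i_def coset_graph_def)
    qed
    obtain \<pi> where contr: "contracting_retraction (cayley_graph G S\<^sub>0) \<L> B \<Lambda>\<^sub>i \<pi>"
      using B \<Lambda>\<^sub>i(1) by blast
    then have \<pi>: "\<And>x. \<pi> x \<in> H i" "\<And>x. x \<in> H i \<Longrightarrow> \<pi> x = x"
      and \<pi>_edge: "\<And>x y. {x, y} \<in> gedges (cayley_graph G S\<^sub>0) \<Longrightarrow>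
        gdist (cayley_graph G S\<^sub>0) (\<pi> x) (\<pi> y) \<le> enat B"
      unfolding contracting_retraction_def \<Lambda>\<^sub>i(2) by simp_all
    have \<pi>_coset: "gdist (cayley_graph G S\<^sub>0) (\<pi> x) (\<pi> y) \<le> enat B"
      if "\<Lambda>' \<in> \<L>" "\<Lambda>' \<noteq> \<Lambda>\<^sub>i" "x \<in> gverts \<Lambda>'" "y \<in> gverts \<Lambda>'" for \<Lambda>' x y
      using contr that unfolding contracting_retraction_def by simp
    \<comment> \<open>The dichotomy behind convexity: an edge is a Rips edge inside
      \<open>H i\<close> or is contracted to length \<open>M i\<close>, a bound fixed before
      \<open>k\<close>.\<close>
    have key_mult: "x \<in> H i \<and> x \<otimes> s \<in> H i \<and> gdist (\<Lambda> i) x (x \<otimes> s) \<le> enat k \<or>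
        gdist (\<Lambda> i) (\<pi> x) (\<pi> (x \<otimes> s)) \<le> enat (M i)"
      if x: "x \<in> carrier G" and s: "s \<in> K" for x s
    proof -
      consider "s \<in> S\<^sub>0" | j where "j \<in> I" "gdist (\<Lambda> j) \<one> s \<le> enat k"
        using s unfolding K_def by auto
      then show ?thesis
      proof cases
        case 1
        have "gdist (cayley_graph G S\<^sub>0) (\<pi> x) (\<pi> (x \<otimes> s)) \<le> enat B"
        proof (cases "s = \<one>")
          case True
          then show ?thesis
            using gdist_refl[of "\<pi> x" "cayley_graph G S\<^sub>0"] x \<pi>(1)
              subgroup.mem_carrier[OF subgroup_H[OF i]] by simp
        next
          case False
          show ?thesis by (rule \<pi>_edge[OF cayley_graph_edgeI[OF x 1 False]])
        qed
        from M[OF i \<pi>(1) \<pi>(1) this] show ?thesis ..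
      next
        case 2
        note s = ball[OF 2]
        define \<Lambda>' where "\<Lambda>' = coset_graph G x (H j) (T j)"
        have \<Lambda>': "\<Lambda>' \<in> \<L>" "gverts \<Lambda>' = x <# H j"
        proof -
          show "\<Lambda>' \<in> \<L>" using x 2(1) unfolding \<Lambda>'_def \<L>_def by blast
        qed (simp add: \<Lambda>'_def coset_graph_def)
        have "x \<in> x <# H j"
          using x subgroup.one_closed[OF subgroup_H[OF 2(1)]] unfolding l_coset_def by force
        then have in': "x \<in> gverts \<Lambda>'" "x \<otimes> s \<in> gverts \<Lambda>'"
          using s unfolding \<Lambda>'(2) by (auto simp: l_coset_def)
        show ?thesis
        proof (cases "\<Lambda>' = \<Lambda>\<^sub>i")
          case True
          then have eq: "x <# H j = H i" using \<Lambda>\<^sub>i(2) \<Lambda>'(2) by simp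
          note HH = l_coset_eq_subgroup[OF subgroup_H[OF 2(1)] subgroup_H[OF i] x eq]
          \<comment> \<open>Equal subgroups have equal generating sets, so the ball of
            \<open>H j\<close> that contains \<open>s\<close> is the ball of
            \<open>H i\<close>.\<close>
          then have \<Lambda>_eq: "\<Lambda> j = \<Lambda> i" using S_eq[OF 2(1) i] unfolding \<Lambda>_def by simp
          have "gdist (\<Lambda> i) (x \<otimes> \<one>) (x \<otimes> s) \<le> enat k"
            by (rule order_trans[OF \<Lambda>(4)[OF i i HH(2)] 2(2)[unfolded \<Lambda>_eq]])
          then show ?thesis using x in' True \<Lambda>\<^sub>i(2) by simp
        next
          case False
          \<comment> \<open>Both ends lie in one other coset, whose projection is bounded as a
            whole; the length of \<open>s\<close> does not enter.\<close>
          show ?thesis using M[OF i \<pi>(1) \<pi>(1) \<pi>_coset[OF \<Lambda>'(1) False in']] ..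
        qed
      qed
    qed
    have key: "x \<in> H i \<and> y \<in> H i \<and> gdist (\<Lambda> i) x y \<le> enat k \<or>
        gdist (\<Lambda> i) (\<pi> x) (\<pi> y) \<le> enat (M i)" if e: "{x, y} \<in> gedges ?\<Gamma>\<^sub>0" for x y
      using cayley_graph_edgeD[OF e] key_mult gdist_commute[of "\<Lambda> i"] by metis
    have short: "gdist (\<Lambda> i) (\<pi> x) (\<pi> y) \<le> enat k" if e: "{x, y} \<in> gedges ?\<Gamma>\<^sub>0" for x y
    proof -
      have "enat (M i) \<le> enat k" using k[OF i] by simp
      with key[OF e] show ?thesis using \<pi>(2) order_trans by metis
    qed
    show ?thesis
    proof (rule convex_subgraph_retraction[where \<Lambda> = "\<Lambda> i" and \<pi> = "\<pi> \<circ> fst" and k = k and B = "M i"])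
      show "connected_graph \<Gamma>" by (rule conn_\<Gamma>)
      show "is_subgraph (\<Gamma>s i) \<Gamma>"
        unfolding \<Gamma>_def \<Gamma>s_def by (rule is_subgraph_map_graph[OF sub_R[OF i] inj])
      show "2 * M i \<le> k" by (rule k[OF i])
      show "(\<pi> \<circ> fst) x \<in> gverts (\<Lambda> i)" for x
        using \<pi>(1) \<Lambda>(2)[OF i i] by simp
    next
      fix p q assume "{p, q} \<in> gedges \<Gamma>"
      then obtain x y where xy: "p = tag x" "q = tag y" "{x, y} \<in> gedges ?\<Gamma>\<^sub>0"
        unfolding \<Gamma>_def by (rule edges_map_graph[OF g\<Gamma>\<^sub>0])
      show "gdist (\<Lambda> i) ((\<pi> \<circ> fst) p) ((\<pi> \<circ> fst) q) \<le> enat k"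
        using short[OF xy(3)] xy by simp
      show "gdist (\<Lambda> i) ((\<pi> \<circ> fst) p) ((\<pi> \<circ> fst) q) \<le> enat (M i)" if "p \<notin> gverts (\<Gamma>s i)"
        using key[OF xy(3)] that verts_R[OF i] xy by (auto simp: \<Gamma>s_def)
      assume "p \<in> gverts (\<Gamma>s i)" "q \<in> gverts (\<Gamma>s i)"
      then have H: "x \<in> H i" "y \<in> H i" using xy verts_R[OF i] by (auto simp: \<Gamma>s_def)
      then have "{x, y} \<in> gedges (?R i)"
        using short[OF xy(3)] \<pi>(2) \<Lambda>(2)[OF i i] edge_in(3)[OF g\<Gamma>\<^sub>0 xy(3)] by (simp add: edges_rips)
      then show "{p, q} \<in> gedges (\<Gamma>s i)"
        unfolding \<Gamma>s_def xy by (rule edges_map_graphI)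
    next
      fix p q n assume pq: "p \<in> gverts (\<Gamma>s i)" "q \<in> gverts (\<Gamma>s i)"
        and le: "gdist (\<Lambda> i) ((\<pi> \<circ> fst) p) ((\<pi> \<circ> fst) q) \<le> enat (k * n)"
      then obtain x y where xy: "p = tag x" "q = tag y" "x \<in> H i" "y \<in> H i"
        using verts_R[OF i] by (auto simp: \<Gamma>s_def)
      have "gdist (?R i) x y \<le> enat n"
        by (rule gdist_rips) (use xy le \<pi>(2) \<Lambda>(2)[OF i i] in auto)
      then show "gdist (\<Gamma>s i) p q \<le> enat n"
        unfolding \<Gamma>s_def xy using gdist_map_graph_le[OF is_graph_rips inj] order_trans by blast
    qed
  qed
  have "graph_isomorphic (\<Gamma>s i) (rips_graph k (cayley_graph (G\<lparr>carrier := H i\<rparr>) (S i)))" for i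
    unfolding \<Gamma>s_def \<Lambda>_def by (rule graph_isomorphic_map_graph[OF is_graph_rips inj])
  moreover have "is_subgraph (\<Gamma>s i) \<Gamma>" if "i \<in> I" for i
    unfolding \<Gamma>_def \<Gamma>s_def by (rule is_subgraph_map_graph[OF sub_R[OF that] inj])
  ultimately show ?thesis
    using conn_\<Gamma> graph_action act(2,3) act_H convex
    by (intro exI[of _ \<Gamma>] exI[of _ tag_action] exI[of _ \<Gamma>s]) blast
qed

end

theorem theorem1p3:
  fixes G :: "('g, 'b) monoid_scheme"
    and I :: "'i set"
    and H S :: "'i \<Rightarrow> 'g set"
  assumes "group G"
    and "finitely_generated G (carrier G)"
    and "finite I"
    and "\<And>i. i \<in> I \<Longrightarrow> subgroup (H i) G"
    and "\<And>i. i \<in> I \<Longrightarrow> finitely_generated G (H i)"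
    and "rel_hyperbolic_group G I H"
    and "\<And>i. i \<in> I \<Longrightarrow> finite_generating_set G (H i) (S i)"
    and "\<And>i j. i \<in> I \<Longrightarrow> j \<in> I \<Longrightarrow> H i = H j \<Longrightarrow> S i = S j"
  shows "\<exists>(\<Gamma> :: ('g \<times> nat) ugraph) \<phi> \<Gamma>s.
    connected_graph \<Gamma> \<and> graph_action G \<Gamma> \<phi> \<and> free_action G \<Gamma> \<phi> \<and> cocompact_action G \<Gamma> \<phi> \<and>
    (\<forall>i\<in>I. is_subgraph (\<Gamma>s i) \<Gamma> \<and>
       (\<exists>k. graph_isomorphic (\<Gamma>s i) (rips_graph k (cayley_graph (G\<lparr>carrier := H i\<rparr>) (S i)))) \<and>
       stabilizes (H i) \<phi> (\<Gamma>s i) \<and>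
       free_action (G\<lparr>carrier := H i\<rparr>) (\<Gamma>s i) \<phi> \<and>
       cocompact_action (G\<lparr>carrier := H i\<rparr>) (\<Gamma>s i) \<phi> \<and>
       convex_subgraph (\<Gamma>s i) \<Gamma>)"
  by (rule group.convex_rips_graphs[OF assms(1,3,4,6-8)])

end
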